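(* Fix $a>b>0$. For each $n$ (with $n^{3/2}>a$), the Markov process $\hat{\boldsymbol{U}}^n=(\hat U^n_1,\ldots,\hat U^n_n)$ has a unique stationary distribution $\pi^{(n)}=\pi^{(n)}_{(a,b)}$ on $\mathbb{N}_0^n/\sqrt n$, given as $$\pi^{(n)}([z_1,\infty)\times\cdots\times[z_n,\infty))=\prod_{i=1}^n\big(\rho^{(n)}_i\big)^{\sqrt n z_i},\qquad z_i\in\mathbb{N}_0/\sqrt n,\ i\in[n],$$ where $$\rho^{(n)}_i=\prod_{j=i}^n\Big(1-\frac{a}{n^{3/2}}+\frac{b}{\sqrt n}\mathbf{1}_{\{j=1\}}\Big),\qquad i\in[n].$$ Furthermore, regarding $\pi^{(n)}$ as a probability measure on $\mathbb{R}_+^\infty$, $\pi^{(n)}\to\mu_{a,b}$ weakly as $n\to\infty$, where $\mu_{a,b}=\mathrm{Exp}(a-b)\otimes\mathrm{Exp}(a)\otimes\mathrm{Exp}(a)\otimes\cdots$.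
   Context: $\mathbb{R}_+=[0,\infty)$; $\mathbb{R}_+^\infty$ has the product topology; $[n]=\{1,\ldots,n\}$; $\mathbb{N}_0=\{0,1,2,\ldots\}$; $\mathbb{N}_0/\sqrt n=\{m/\sqrt n:m\in\mathbb{N}_0\}$. $\mathrm{Exp}(\theta)$ is the exponential law with mean $\theta^{-1}$. A probability measure on $\mathbb{R}_+^n$ is regarded as one on $\mathbb{R}_+^\infty$ by taking the law of $(V_1,\ldots,V_n,0,0,\ldots)$. System with pauses. Let $(\tilde{\mathcal{A}}_i,\tilde{\mathcal{D}}_i)_{i\in[n]}$ be mutually independent Poisson random measures on $\mathbb{R}_+\times\mathbb{R}_+$ with Lebesgue intensity. Let $\gamma^n_1=n-an^{-1/2}+bn^{1/2}$ and $\gamma^n_i=n-an^{-1/2}$ for $2\le i\le n$. Given an ordered initial vector $x^n_1\le\cdots\le x^n_n$ in $\mathbb{N}_0$, the ranked queue lengths $Y^n_1\le\cdots\le Y^n_n$ solve, for $i\in[n]$, $$Y^n_i(t)=x^n_i+\int_{[0,t]\times\mathbb{R}_+}1_{[0,\gamma^n_i]}(r)1_{\{Y^n_i(s-)<Y^n_{i+1}(s-)\}}\tilde{\mathcal{A}}_i(ds\,dr)-\int_{[0,t]\times\mathbb{R}_+}1_{[0,n]}(r)1_{\{Y^n_i(s-)>Y^n_{i-1}(s-)\}}\tilde{\mathcal{D}}_i(ds\,dr),$$ with $Y^n_0\equiv0$ and $Y^n_{n+1}\equiv\infty$. The gaps are $U^n_i=Y^n_i-Y^n_{i-1}$, $i\in[n]$,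 and $\hat U^n_i=U^n_i/\sqrt n$; $\hat{\boldsymbol{U}}^n$ is a continuous-time Markov chain on $\mathbb{N}_0^n/\sqrt n$. *)

theory Defs
  imports "HOL-Probability.Probability"
begin

subsection \<open>Poisson random measures\<close>

definition lebesgue_quadrant :: "(real \<times> real) measure" where
  "lebesgue_quadrant = restrict_space lborel ({0..} \<times> {0..})"

text \<open>A random measure \<open>N\<close> on the space of \<open>\<nu>\<close>, where \<open>N \<omega> B\<close> is Poisson distributed with mean
  \<open>\<nu> B\<close> (and almost surely infinite if \<open>\<nu> B\<close> is), independently over disjoint sets.\<close>

definition poisson_random_measure :: "'w measure \<Rightarrow> 'a measure \<Rightarrow> ('w \<Rightarrow> 'a measure) \<Rightarrow> bool" where
  "poisson_random_measure M \<nu> N \<longleftrightarrow>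
     (\<forall>\<omega>\<in>space M. sets (N \<omega>) = sets \<nu>) \<and>
     (\<forall>B\<in>sets \<nu>. (\<lambda>\<omega>. emeasure (N \<omega>) B) \<in> borel_measurable M) \<and>
     (\<forall>B\<in>sets \<nu>. emeasure \<nu> B < \<infinity> \<longrightarrow>
        (\<forall>k::nat. measure M {\<omega> \<in> space M. emeasure (N \<omega>) B = of_nat k} =
                  measure \<nu> B ^ k / fact k * exp (- measure \<nu> B))) \<and>
     (\<forall>B\<in>sets \<nu>. emeasure \<nu> B = \<infinity> \<longrightarrow> (AE \<omega> in M. emeasure (N \<omega>) B = \<infinity>)) \<and>
     (\<forall>(B :: nat \<Rightarrow> 'a set) m. B ` {..<m} \<subseteq> sets \<nu> \<and> disjoint_family_on B {..<m} \<longrightarrow>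
        prob_space.indep_vars M (\<lambda>_. borel) (\<lambda>j \<omega>. emeasure (N \<omega>) (B j)) {..<m})"

text \<open>Independence of random measures refers to the sigma-algebras generated by all the
  evaluations \<open>\<omega> \<mapsto> N k \<omega> B\<close>; hence each random measure is read as a random element of a
  product indexed by the measurable sets.\<close>

definition indep_random_measures ::
  "'w measure \<Rightarrow> 'a measure \<Rightarrow> ('k \<Rightarrow> 'w \<Rightarrow> 'a measure) \<Rightarrow> 'k set \<Rightarrow> bool" where
  "indep_random_measures M \<nu> N K \<longleftrightarrow>
     prob_space.indep_vars M (\<lambda>_. PiM (sets \<nu>) (\<lambda>_. borel))
       (\<lambda>k \<omega>. \<lambda>B\<in>sets \<nu>. emeasure (N k \<omega>) B) K"


subsection \<open>The system with pauses\<close>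

definition arrival_rate :: "real \<Rightarrow> real \<Rightarrow> nat \<Rightarrow> nat \<Rightarrow> real" where
  "arrival_rate a b n i = real n - a / sqrt (real n) + (if i = 1 then b * sqrt (real n) else 0)"

definition cadlag :: "(real \<Rightarrow> real) \<Rightarrow> bool" where
  "cadlag f \<longleftrightarrow> (\<forall>t\<ge>0. (f \<longlongrightarrow> f t) (at_right t)) \<and> (\<forall>t>0. \<exists>l. (f \<longlongrightarrow> l) (at_left t))"

definition left_limit :: "(real \<Rightarrow> real) \<Rightarrow> real \<Rightarrow> real" where
  "left_limit f s = Lim (at_left s) f"

definition ordered_initial :: "nat \<Rightarrow> (nat \<Rightarrow> real) \<Rightarrow> bool" where
  "ordered_initial n x \<longleftrightarrow> x ` {1..n} \<subseteq> \<nat> \<and> mono_on {1..n} x"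

text \<open>\<open>Y i t \<omega>\<close> is the length at time \<open>t\<close> of the \<open>i\<close>-th shortest of the \<open>n\<close> queues.  The convention
  that queue \<open>n + 1\<close> is infinite is encoded by the disjunct \<open>i = n\<close>.  The left limit at time
  \<open>0\<close> is unspecified, but almost surely no point of \<open>A\<close> or \<open>D\<close> has time coordinate \<open>0\<close>.\<close>

definition ranked_queues ::
  "real \<Rightarrow> real \<Rightarrow> nat \<Rightarrow> 'w measure \<Rightarrow> (nat \<Rightarrow> 'w \<Rightarrow> (real \<times> real) measure) \<Rightarrow>
   (nat \<Rightarrow> 'w \<Rightarrow> (real \<times> real) measure) \<Rightarrow> (nat \<Rightarrow> real) \<Rightarrow> (nat \<Rightarrow> real \<Rightarrow> 'w \<Rightarrow> real) \<Rightarrow> bool" where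
  "ranked_queues a b n M A D x Y \<longleftrightarrow>
     (\<forall>i\<in>{0..n}. \<forall>t\<ge>0. Y i t \<in> borel_measurable M) \<and>
     (AE \<omega> in M.
        (\<forall>t\<ge>0. Y 0 t \<omega> = 0) \<and>
        (\<forall>i\<in>{1..n}. cadlag (\<lambda>t. Y i t \<omega>)) \<and>
        (\<forall>i\<in>{1..n}. \<forall>t\<ge>0.
           Y i t \<omega> = x i
             + (\<integral>(s, r). indicator {0..t} s * indicator {0..arrival_rate a b n i} r *
                  of_bool (i = n \<or>
                    left_limit (\<lambda>u. Y i u \<omega>) s < left_limit (\<lambda>u. Y (i + 1) u \<omega>) s) \<partial>A i \<omega>)
             - (\<integral>(s, r). indicator {0..t} s * indicator {0..real n} r *
                  of_bool (left_limit (\<lambda>u. Y i u \<omega>) s > left_limit (\<lambda>u. Y (i - 1) u \<omega>) s)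
                  \<partial>D i \<omega>)))"

text \<open>\<open>Y x\<close> is the solution with initial vector \<open>x\<close>.\<close>

definition system_with_pauses ::
  "real \<Rightarrow> real \<Rightarrow> nat \<Rightarrow> 'w measure \<Rightarrow> (nat \<Rightarrow> 'w \<Rightarrow> (real \<times> real) measure) \<Rightarrow>
   (nat \<Rightarrow> 'w \<Rightarrow> (real \<times> real) measure) \<Rightarrow>
   ((nat \<Rightarrow> real) \<Rightarrow> nat \<Rightarrow> real \<Rightarrow> 'w \<Rightarrow> real) \<Rightarrow> bool" where
  "system_with_pauses a b n M A D Y \<longleftrightarrow>
     prob_space M \<and>
     (\<forall>i\<in>{1..n}. poisson_random_measure M lebesgue_quadrant (A i) \<and>
                  poisson_random_measure M lebesgue_quadrant (D i)) \<and>
     indep_random_measures M lebesgue_quadrant (case_sum A D) ({1..n} <+> {1..n}) \<and>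
     (\<forall>x. ordered_initial n x \<longrightarrow> ranked_queues a b n M A D x (Y x))"


subsection \<open>The scaled gap process and its stationary distributions\<close>

definition gap_space :: "nat \<Rightarrow> (nat \<Rightarrow> real) set" where
  "gap_space n = (\<Pi>\<^sub>E i\<in>{1..n}. range (\<lambda>m::nat. real m / sqrt (real n)))"

definition scaled_gaps :: "nat \<Rightarrow> (nat \<Rightarrow> real) \<Rightarrow> nat \<Rightarrow> real" where
  "scaled_gaps n y = (\<lambda>i\<in>{1..n}. (y i - y (i - 1)) / sqrt (real n))"

definition queues_of_gaps :: "nat \<Rightarrow> (nat \<Rightarrow> real) \<Rightarrow> nat \<Rightarrow> real" where
  "queues_of_gaps n u = (\<lambda>i. \<Sum>j=1..i. sqrt (real n) * u j)"

text \<open>The probability that the scaled gap process started at \<open>u\<close> is in \<open>B\<close> at time \<open>t\<close>.\<close>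

definition gap_transition ::
  "nat \<Rightarrow> 'w measure \<Rightarrow> ((nat \<Rightarrow> real) \<Rightarrow> nat \<Rightarrow> real \<Rightarrow> 'w \<Rightarrow> real) \<Rightarrow>
   real \<Rightarrow> (nat \<Rightarrow> real) \<Rightarrow> (nat \<Rightarrow> real) set \<Rightarrow> ennreal" where
  "gap_transition n M Y t u B =
     emeasure M {\<omega> \<in> space M. scaled_gaps n (\<lambda>i. Y (queues_of_gaps n u) i t \<omega>) \<in> B}"

definition stationary_distribution ::
  "'a set \<Rightarrow> (real \<Rightarrow> 'a \<Rightarrow> 'a set \<Rightarrow> ennreal) \<Rightarrow> 'a measure \<Rightarrow> bool" where
  "stationary_distribution S P \<pi> \<longleftrightarrow>
     prob_space \<pi> \<and> sets \<pi> = sets (count_space S) \<and>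
     (\<forall>t\<ge>0. \<forall>B\<subseteq>S. (\<integral>\<^sup>+u. P t u B \<partial>\<pi>) = emeasure \<pi> B)"

definition pause_rho :: "real \<Rightarrow> real \<Rightarrow> nat \<Rightarrow> nat \<Rightarrow> real" where
  "pause_rho a b n i =
     (\<Prod>j=i..n. 1 - a / real n powr (3/2) + b / sqrt (real n) * of_bool (j = 1))"


subsection \<open>Probability measures on the space of nonnegative sequences\<close>

text \<open>Sequences \<open>V\<^sub>1, V\<^sub>2, \<dots>\<close> are functions on \<open>nat\<close>, so \<open>V\<^sub>i\<close> is the value at \<open>i - 1\<close>.
  The topology of \<open>nat \<Rightarrow> real\<close> is the product topology.\<close>

definition nonneg_seqs :: "(nat \<Rightarrow> real) set" where
  "nonneg_seqs = {v. \<forall>k. 0 \<le> v k}"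

definition as_seq_measure :: "nat \<Rightarrow> (nat \<Rightarrow> real) measure \<Rightarrow> (nat \<Rightarrow> real) measure" where
  "as_seq_measure n \<pi> =
     distr \<pi> (restrict_space borel nonneg_seqs) (\<lambda>v k. if k < n then v (k + 1) else 0)"

definition Exp_law :: "real \<Rightarrow> real measure" where
  "Exp_law \<theta> = restrict_space (density lborel (exponential_density \<theta>)) {0..}"

definition mu_limit :: "real \<Rightarrow> real \<Rightarrow> (nat \<Rightarrow> real) measure" where
  "mu_limit a b = PiM UNIV (\<lambda>k. Exp_law (if k = 0 then a - b else a))"

definition weakly_converges_on ::
  "'a::topological_space set \<Rightarrow> (nat \<Rightarrow> 'a measure) \<Rightarrow> 'a measure \<Rightarrow> bool" where
  "weakly_converges_on S \<mu>s \<mu> \<longleftrightarrow>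
     (\<forall>f :: 'a \<Rightarrow> real. continuous_on S f \<and> bounded (f ` S) \<longrightarrow>
        (\<lambda>n. \<integral>x. f x \<partial>\<mu>s n) \<longlonglongrightarrow> (\<integral>x. f x \<partial>\<mu>))"

end

theory Submission
  imports Defs "HOL-Real_Asymp.Real_Asymp"
begin

text \<open>Think of gap \<open>i\<close> as a box holding \<open>U\<^sub>i\<close> particles, with an infinite reservoir in place
of box \<open>n + 1\<close>. An arrival at queue \<open>i\<close> moves a particle from box \<open>i + 1\<close> to box \<open>i\<close>, at rate
\<open>arrival_rate a b n i\<close>; a departure from queue \<open>i\<close> moves a particle back, at rate \<open>n\<close>. The pauses
suppress exactly the moves out of an empty box. So the gaps form a reversible chain: geometric product
weights with ratios \<open>r\<^sub>1, \<dots>, r\<^sub>n\<close> and \<open>r\<^sub>n\<^sub>+\<^sub>1 = 1\<close> are in detailed balance as soon as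
\<open>n r\<^sub>i = arrival_rate a b n i \<cdot> r\<^sub>i\<^sub>+\<^sub>1\<close> (\<open>detailed_balance_integrals\<close>), and
\<open>pause_rho\<close> is the solution of this recursion (\<open>pause_rho_rec\<close>). The condition \<open>b < a\<close> makes
\<open>r\<^sub>1 < 1\<close>, by Bernoulli's inequality (\<open>pause_rho_less_1\<close>).

The queues are given by stochastic integrals, and the link with the chain goes through discretised time.
Cut \<open>[0, t]\<close> into \<open>m\<close> slots of length \<open>h = t / m\<close> and prescribe by a word which slots contain no
point and which contain a single one, and of which of the \<open>2 n\<close> random measures. Within a slot that has a
single point the queues are constant up to that point, so the integrals apply the corresponding move
(\<open>path_follows_word\<close>). The events of different words are disjoint and have explicit product
probabilities, which bounds the transition probabilities from below (\<open>gap_transition_ge_words\<close>). One slot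
of this lower bound is the operator \<open>exp (- h \<Lambda>) (I + h \<Sum>\<^sub>j \<lambda>\<^sub>j T\<^sub>j)\<close>, where \<open>T\<^sub>j\<close> applies
the move of source \<open>j\<close>, \<open>\<lambda>\<^sub>j\<close> is its rate and \<open>\<Lambda>\<close> the sum of the rates. By detailed balance it
multiplies the reversible law \<open>\<pi>\<close> by \<open>exp (- h \<Lambda>) (1 + h \<Lambda>)\<close>, and the \<open>m\<close>-th power of this
number tends to \<open>1\<close>. Therefore \<open>\<pi> P\<^sub>t \<ge> \<pi>\<close> on every set, and the same inequality for the
complement turns this into equality (\<open>transition_integral_eq\<close>).

The same words show that every state is occupied at time \<open>1\<close> with positive probability, from every initial state,
which forces two stationary distributions to agree (\<open>stationary_distribution_unique\<close>).

For the limit, if \<open>E\<close> is exponential with parameter \<open>\<theta>\<close> then \<open>\<lfloor>E / c\<rfloor>\<close> is geometric with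
ratio \<open>exp (- \<theta> c)\<close>. Choosing \<open>c\<^sub>i = - ln r\<^sub>i / \<theta>\<^sub>i\<close> realises the stationary law of
every \<open>n\<close> as a rounding of one sequence with law \<open>mu_limit a b\<close>. The mesh in coordinate \<open>i\<close>, after scaling,
is \<open>1 / sqrt n\<close> and \<open>c\<^sub>i sqrt n\<close> tends to \<open>1\<close>, so the roundings converge pointwise to
the identity, and dominated convergence gives weak convergence (\<open>gap_law_weak_limit\<close>).\<close>

section \<open>Counts of a Poisson random measure\<close>

lemma poisson_random_measureD:
  fixes k m :: nat and C :: "nat \<Rightarrow> 'a set"
  assumes "poisson_random_measure M \<nu> N"
  shows "\<omega> \<in> space M \<Longrightarrow> sets (N \<omega>) = sets \<nu>"
    and "B \<in> sets \<nu> \<Longrightarrow> (\<lambda>\<omega>. emeasure (N \<omega>) B) \<in> borel_measurable M"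
    and "B \<in> sets \<nu> \<Longrightarrow> emeasure \<nu> B < \<infinity> \<Longrightarrow>
      measure M {\<omega> \<in> space M. emeasure (N \<omega>) B = of_nat k} =
      measure \<nu> B ^ k / fact k * exp (- measure \<nu> B)"
    and "C ` {..<m} \<subseteq> sets \<nu> \<Longrightarrow> disjoint_family_on C {..<m} \<Longrightarrow>
      prob_space.indep_vars M (\<lambda>_. borel) (\<lambda>k \<omega>. emeasure (N \<omega>) (C k)) {..<m}"
proof -
  note N = assms[unfolded poisson_random_measure_def]
  show "\<omega> \<in> space M \<Longrightarrow> sets (N \<omega>) = sets \<nu>"
    using N[THEN conjunct1] by blast
  show "B \<in> sets \<nu> \<Longrightarrow> (\<lambda>\<omega>. emeasure (N \<omega>) B) \<in> borel_measurable M"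
    using N[THEN conjunct2, THEN conjunct1] by blast
  show "B \<in> sets \<nu> \<Longrightarrow> emeasure \<nu> B < \<infinity> \<Longrightarrow>
      measure M {\<omega> \<in> space M. emeasure (N \<omega>) B = of_nat k} =
      measure \<nu> B ^ k / fact k * exp (- measure \<nu> B)"
    using N[THEN conjunct2, THEN conjunct2, THEN conjunct1] by blast
  show "C ` {..<m} \<subseteq> sets \<nu> \<Longrightarrow> disjoint_family_on C {..<m} \<Longrightarrow>
      prob_space.indep_vars M (\<lambda>_. borel) (\<lambda>k \<omega>. emeasure (N \<omega>) (C k)) {..<m}"
    by (rule N[THEN conjunct2, THEN conjunct2, THEN conjunct2, THEN conjunct2,
          THEN spec, THEN spec, THEN mp]) (rule conjI)
qed

lemma poisson_AE_finite_count:
  assumes "prob_space M" and N: "poisson_random_measure M \<nu> N"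
    and B: "B \<in> sets \<nu>" and fin: "emeasure \<nu> B < \<infinity>"
  shows "AE \<omega> in M. \<exists>k::nat. emeasure (N \<omega>) B = of_nat k"
proof -
  interpret prob_space M by fact
  define E where "E k = {\<omega> \<in> space M. emeasure (N \<omega>) B = of_nat k}" for k :: nat
  have meas[measurable]: "(\<lambda>\<omega>. emeasure (N \<omega>) B) \<in> borel_measurable M"
    by (rule poisson_random_measureD(2)[OF N B])
  have E_sets: "E k \<in> sets M" for k
    unfolding E_def by measurable
  have disj: "disjoint_family E"
    by (auto simp: disjoint_family_on_def E_def)
  have "(\<lambda>k. prob (E k)) sums prob (\<Union>k. E k)"
    using E_sets disj by (intro finite_measure_UNION) auto
  moreover have "prob (E k) = measure \<nu> B ^ k / fact k * exp (- measure \<nu> B)" for k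
    unfolding E_def by (rule poisson_random_measureD(3)[OF N B fin])
  moreover have "(\<lambda>k. measure \<nu> B ^ k / fact k * exp (- measure \<nu> B)) sums
      (exp (measure \<nu> B) * exp (- measure \<nu> B))"
    using exp_converges[of "measure \<nu> B"]
    by (intro sums_mult2) (simp add: scaleR_conv_of_real divide_inverse mult.commute)
  ultimately have "prob (\<Union>k. E k) = 1"
    by (simp add: sums_iff exp_minus)
  then have "AE \<omega> in M. \<omega> \<in> (\<Union>k. E k)"
    by (rule AE_prob_1)
  then show ?thesis
    by (auto simp: E_def)
qed

text \<open>Two layers of independence are combined: between the random measures, as random elements
of a product over all measurable sets, and within each of them over disjoint sets.\<close>

lemma indep_poisson_counts:
  fixes m :: nat and B :: "'j \<Rightarrow> nat \<Rightarrow> 'a set" and c :: "'j \<Rightarrow> nat \<Rightarrow> nat"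
  assumes "prob_space M"
    and J: "finite J" "J \<noteq> {}"
    and N: "\<And>j. j \<in> J \<Longrightarrow> poisson_random_measure M \<nu> (N j)"
    and indep: "indep_random_measures M \<nu> N J"
    and m: "0 < m"
    and B: "\<And>j k. j \<in> J \<Longrightarrow> k < m \<Longrightarrow> B j k \<in> sets \<nu>"
    and disj: "\<And>j. j \<in> J \<Longrightarrow> disjoint_family_on (B j) {..<m}"
    and fin: "\<And>j k. j \<in> J \<Longrightarrow> k < m \<Longrightarrow> emeasure \<nu> (B j k) < \<infinity>"
  shows "measure M {\<omega> \<in> space M. \<forall>j\<in>J. \<forall>k<m. emeasure (N j \<omega>) (B j k) = of_nat (c j k)} =
    (\<Prod>j\<in>J. \<Prod>k<m. measure \<nu> (B j k) ^ c j k / fact (c j k) * exp (- measure \<nu> (B j k)))"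
proof -
  interpret prob_space M by fact
  define X where "X j \<omega> = (\<lambda>B\<in>sets \<nu>. emeasure (N j \<omega>) B)" for j \<omega>
  define T where "T j = {x \<in> space (PiM (sets \<nu>) (\<lambda>_. borel)). \<forall>k\<in>{..<m}. x (B j k) = (of_nat (c j k) :: ennreal)}"
    for j
  have [measurable]: "T j \<in> sets (PiM (sets \<nu>) (\<lambda>_. borel))" if "j \<in> J" for j
  proof -
    have "{x \<in> space (PiM (sets \<nu>) (\<lambda>_. borel)). x (B j k) = (of_nat (c j k) :: ennreal)}
        \<in> sets (PiM (sets \<nu>) (\<lambda>_. borel))" if "k \<in> {..<m}" for k
    proof -
      have [measurable]: "(\<lambda>x. x (B j k)) \<in> borel_measurable (PiM (sets \<nu>) (\<lambda>_. borel :: ennreal measure))"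
        using B[OF \<open>j \<in> J\<close>] that by (auto intro: measurable_component_singleton)
      show ?thesis by measurable
    qed
    then have "{x \<in> space (PiM (sets \<nu>) (\<lambda>_. borel)). \<forall>k\<in>{..<m}. x (B j k) = (of_nat (c j k) :: ennreal)}
        \<in> sets (PiM (sets \<nu>) (\<lambda>_. borel))"
      by (rule sets.sets_Collect_finite_All) auto
    then show ?thesis unfolding T_def .
  qed
  have XT: "X j -` T j \<inter> space M = {\<omega> \<in> space M. \<forall>k<m. emeasure (N j \<omega>) (B j k) = of_nat (c j k)}"
    if "j \<in> J" for j
    using B[OF that] by (auto simp: T_def X_def space_PiM)
  have "indep_vars (\<lambda>_. PiM (sets \<nu>) (\<lambda>_. borel)) X J"
    using indep by (simp add: indep_random_measures_def X_def[abs_def])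
  then have "prob (\<Inter>j\<in>J. X j -` T j \<inter> space M) = (\<Prod>j\<in>J. prob (X j -` T j \<inter> space M))"
    by (rule indep_varsD) (use J in auto)
  moreover have "(\<Inter>j\<in>J. X j -` T j \<inter> space M) =
      {\<omega> \<in> space M. \<forall>j\<in>J. \<forall>k<m. emeasure (N j \<omega>) (B j k) = of_nat (c j k)}"
  proof -
    have "(\<Inter>j\<in>J. X j -` T j \<inter> space M) =
        (\<Inter>j\<in>J. {\<omega> \<in> space M. \<forall>k<m. emeasure (N j \<omega>) (B j k) = of_nat (c j k)})"
      using XT by (intro INF_cong refl) blast
    then show ?thesis
      using J by blast
  qed
  moreover have "prob (X j -` T j \<inter> space M) =
      (\<Prod>k<m. measure \<nu> (B j k) ^ c j k / fact (c j k) * exp (- measure \<nu> (B j k)))" if j: "j \<in> J" for j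
  proof -
    have "indep_vars (\<lambda>_. borel) (\<lambda>k \<omega>. emeasure (N j \<omega>) (B j k)) {..<m}"
      by (rule poisson_random_measureD(4)[OF N[OF j] _ disj[OF j]]) (use B[OF j] in blast)
    then have "prob (\<Inter>k\<in>{..<m}. (\<lambda>\<omega>. emeasure (N j \<omega>) (B j k)) -` {of_nat (c j k)} \<inter> space M) =
        (\<Prod>k<m. prob ((\<lambda>\<omega>. emeasure (N j \<omega>) (B j k)) -` {of_nat (c j k)} \<inter> space M))"
      by (rule indep_varsD) (use m in auto)
    moreover have "(\<Inter>k\<in>{..<m}. (\<lambda>\<omega>. emeasure (N j \<omega>) (B j k)) -` {of_nat (c j k)} \<inter> space M) =
        X j -` T j \<inter> space M"
      using m unfolding XT[OF j] by blast
    moreover have "prob ((\<lambda>\<omega>. emeasure (N j \<omega>) (B j k)) -` {of_nat (c j k)} \<inter> space M) =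
        measure \<nu> (B j k) ^ c j k / fact (c j k) * exp (- measure \<nu> (B j k))" if "k < m" for k
    proof -
      have "(\<lambda>\<omega>. emeasure (N j \<omega>) (B j k)) -` {of_nat (c j k)} \<inter> space M =
          {\<omega> \<in> space M. emeasure (N j \<omega>) (B j k) = of_nat (c j k)}"
        by auto
      then show ?thesis
        using poisson_random_measureD(3)[OF N[OF j] B[OF j that] fin[OF j that]] by simp
    qed
    ultimately show ?thesis by simp
  qed
  ultimately show ?thesis by simp
qed

lemma poisson_AE_null:
  assumes "prob_space M" and N: "poisson_random_measure M \<nu> N"
    and B: "B \<in> sets \<nu>" and null: "emeasure \<nu> B = 0"
  shows "AE \<omega> in M. emeasure (N \<omega>) B = 0"
proof -
  interpret prob_space M by fact
  have "prob {\<omega> \<in> space M. emeasure (N \<omega>) B = of_nat 0} = measure \<nu> B ^ 0 / fact 0 * exp (- measure \<nu> B)"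
    by (rule poisson_random_measureD(3)[OF N B]) (simp add: null)
  then have "prob {\<omega> \<in> space M. emeasure (N \<omega>) B = 0} = 1"
    using null by (simp add: measure_def)
  from AE_prob_1[OF this] show ?thesis by auto
qed

section \<open>The points of a random measure in time order\<close>

text \<open>The integrands of the queue equations depend on the mark of a point only through a threshold
\<open>c\<close>. Discarding the points above the threshold and forgetting the marks leaves a measure on the time axis.\<close>

definition time_marginal :: "real \<Rightarrow> (real \<times> real) measure \<Rightarrow> real measure" where
  "time_marginal c N = distr (restrict_space N ({0..} \<times> {0..c})) borel fst"

lemma quadrant_rectangle_sets:
  assumes "G \<in> sets borel" "H \<in> sets borel" "G \<subseteq> {0..}" "H \<subseteq> {0..}"
  shows "G \<times> H \<in> sets lebesgue_quadrant"
proof -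
  have "G \<times> H \<in> sets (lborel \<Otimes>\<^sub>M lborel)"
    using assms by auto
  then have "G \<times> H \<in> sets lborel"
    unfolding lborel_prod .
  moreover have "G \<times> H = ({0..} \<times> {0..}) \<inter> (G \<times> H)"
    using assms by auto
  ultimately show ?thesis
    unfolding lebesgue_quadrant_def sets_restrict_space by blast
qed

lemma space_quadrant: "space lebesgue_quadrant = {0..} \<times> {0..}"
  by (simp add: lebesgue_quadrant_def space_restrict_space)

lemma emeasure_quadrant_rectangle:
  assumes "0 \<le> s" "s \<le> t" "0 \<le> c"
  shows "emeasure lebesgue_quadrant ({s<..t} \<times> {0..c}) = ennreal ((t - s) * c)"
    and "emeasure lebesgue_quadrant ({s..t} \<times> {0..c}) = ennreal ((t - s) * c)"
proof -
  have Q: "({0..} \<times> {0..} :: (real \<times> real) set) \<in> sets lborel"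
    unfolding lborel_prod[symmetric] by (intro pair_measureI) auto
  have "emeasure lebesgue_quadrant (G \<times> {0..c}) = emeasure lborel G * ennreal c"
    if "G \<in> sets borel" "G \<subseteq> {0..}" for G
  proof -
    have "emeasure lebesgue_quadrant (G \<times> {0..c}) = emeasure (lborel \<Otimes>\<^sub>M lborel) (G \<times> {0..c})"
      unfolding lebesgue_quadrant_def lborel_prod
      by (rule emeasure_restrict_space) (use Q that in auto)
    also have "\<dots> = emeasure lborel G * emeasure lborel {0..c}"
      by (rule lborel.emeasure_pair_measure_Times) (use that in auto)
    finally show ?thesis using assms by simp
  qed
  from this[of "{s<..t}"] this[of "{s..t}"]
  show "emeasure lebesgue_quadrant ({s<..t} \<times> {0..c}) = ennreal ((t - s) * c)"
    and "emeasure lebesgue_quadrant ({s..t} \<times> {0..c}) = ennreal ((t - s) * c)"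
    using assms by (auto simp: ennreal_mult subset_eq)
qed

context
  fixes N :: "(real \<times> real) measure" and c :: real
  assumes sets_N: "sets N = sets lebesgue_quadrant"
begin

lemma space_quadrant_measure: "space N = {0..} \<times> {0..}"
  using sets_eq_imp_space_eq[OF sets_N] by (simp add: space_quadrant)

lemma emeasure_time_marginal:
  assumes G: "G \<in> sets borel" "G \<subseteq> {0..}"
  shows "emeasure (time_marginal c N) G = emeasure N (G \<times> {0..c})"
proof -
  have S: "{0..} \<times> {0..c} \<in> sets N"
    unfolding sets_N by (rule quadrant_rectangle_sets) auto
  have "fst \<in> measurable lborel (borel :: real measure)"
    unfolding lborel_prod[symmetric] by measurable
  then have "fst \<in> measurable lebesgue_quadrant (borel :: real measure)"
    unfolding lebesgue_quadrant_def by (rule measurable_restrict_space1)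
  then have "fst \<in> measurable N (borel :: real measure)"
    by (simp cong: measurable_cong_sets add: sets_N)
  then have fst: "fst \<in> measurable (restrict_space N ({0..} \<times> {0..c})) (borel :: real measure)"
    by (rule measurable_restrict_space1)
  have "fst -` G \<inter> space (restrict_space N ({0..} \<times> {0..c})) = G \<times> {0..c}"
    using G by (auto simp: space_restrict_space space_quadrant_measure)
  then show ?thesis
    unfolding time_marginal_def using S G
    by (subst emeasure_distr[OF fst]) (auto intro!: emeasure_restrict_space)
qed

lemma integral_marked_points:
  assumes P: "{0..t} \<inter> {s. P s} \<in> sets borel"
  shows "(\<integral>(s, r). indicator {0..t} s * indicator {0..c} r * of_bool (P s) \<partial>N) =
    measure (time_marginal c N) ({0..t} \<inter> {s. P s})"
proof -
  have "(\<integral>(s, r). indicator {0..t} s * indicator {0..c} r * of_bool (P s) \<partial>N) =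
      (\<integral>z. indicator (({0..t} \<inter> {s. P s}) \<times> {0..c}) z \<partial>N :: real)"
    by (intro Bochner_Integration.integral_cong) (auto simp: indicator_def of_bool_def split: if_splits)
  also have "\<dots> = measure N ((({0..t} \<inter> {s. P s}) \<times> {0..c}) \<inter> space N)"
    by simp
  also have "(({0..t} \<inter> {s. P s}) \<times> {0..c}) \<inter> space N = ({0..t} \<inter> {s. P s}) \<times> {0..c}"
    by (auto simp: space_quadrant_measure)
  also have "measure N (({0..t} \<inter> {s. P s}) \<times> {0..c}) =
      measure (time_marginal c N) ({0..t} \<inter> {s. P s})"
    unfolding measure_def
    by (rule arg_cong[where f = enn2real], rule emeasure_time_marginal[OF P, symmetric]) auto
  finally show ?thesis .
qed

end

text \<open>An integer valued measure of total mass one is a point mass. Integrality is only asked of the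
intervals with rational right end, so that it holds simultaneously for almost every outcome. Such an
interval has mass \<open>0\<close> or \<open>1\<close>, so one of \<open>(\<alpha>, q]\<close> and \<open>(q, \<beta>]\<close> is null for each rational \<open>q\<close>.
Removing these countably many null intervals leaves a set of mass one that cannot contain two points, since a rational between them would separate them.\<close>

lemma unit_atom:
  fixes \<tau> :: "real measure"
  assumes [measurable_cong]: "sets \<tau> = sets borel"
    and unit: "emeasure \<tau> {\<alpha><..\<beta>} = 1"
    and count: "\<And>q. q \<in> \<rat> \<Longrightarrow> \<alpha> < q \<Longrightarrow> q < \<beta> \<Longrightarrow> \<exists>k::nat. emeasure \<tau> {\<alpha><..q} = of_nat k"
  obtains s where "\<alpha> < s" "s \<le> \<beta>"
    and "\<And>G. G \<in> sets borel \<Longrightarrow> G \<subseteq> {\<alpha><..\<beta>} \<Longrightarrow> emeasure \<tau> G = indicator G s"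
proof -
  have [simp]: "space \<tau> = UNIV"
    using sets_eq_imp_space_eq[OF assms(1)] by simp
  have [simp]: "G \<in> sets \<tau> \<longleftrightarrow> G \<in> sets borel" for G
    using assms(1) by simp
  define Q0 where "Q0 = {q \<in> \<rat>. \<alpha> < q \<and> q < \<beta> \<and> emeasure \<tau> {\<alpha><..q} = 0}"
  define Q1 where "Q1 = {q \<in> \<rat>. \<alpha> < q \<and> q < \<beta> \<and> emeasure \<tau> {\<alpha><..q} = 1}"
  define Z where "Z = (\<Union>q\<in>Q0. {\<alpha><..q}) \<union> (\<Union>q\<in>Q1. {q<..\<beta>})"
  have Q01: "q \<in> Q0 \<or> q \<in> Q1" if q: "q \<in> \<rat>" "\<alpha> < q" "q < \<beta>" for q
  proof -
    obtain k :: nat where k: "emeasure \<tau> {\<alpha><..q} = of_nat k"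
      using count[OF q] by auto
    have "emeasure \<tau> {\<alpha><..q} \<le> emeasure \<tau> {\<alpha><..\<beta>}"
      using that by (intro emeasure_mono) auto
    then have "k = 0 \<or> k = 1"
      by (auto simp: k unit)
    then show ?thesis
      using that k by (auto simp: Q0_def Q1_def)
  qed
  have "countable Q0" "countable Q1"
    unfolding Q0_def Q1_def by (auto intro: countable_subset[OF _ countable_rat])
  moreover have "{\<alpha><..q} \<in> null_sets \<tau>" if "q \<in> Q0" for q
    using that by (auto simp: Q0_def null_sets_def)
  moreover have "{q<..\<beta>} \<in> null_sets \<tau>" if "q \<in> Q1" for q
  proof -
    have "emeasure \<tau> ({\<alpha><..\<beta>} - {\<alpha><..q}) = emeasure \<tau> {\<alpha><..\<beta>} - emeasure \<tau> {\<alpha><..q}"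
      using that by (intro emeasure_Diff) (auto simp: Q1_def)
    moreover have "{\<alpha><..\<beta>} - {\<alpha><..q} = {q<..\<beta>}"
      using that by (auto simp: Q1_def)
    ultimately show ?thesis
      using that unit by (auto simp: Q1_def null_sets_def)
  qed
  ultimately have Z: "Z \<in> null_sets \<tau>"
    unfolding Z_def by (intro null_sets.Un null_sets_UN') auto
  have "emeasure \<tau> ({\<alpha><..\<beta>} - Z) = 1"
    using Z unit by (subst emeasure_Diff_null_set) auto
  then have "{\<alpha><..\<beta>} - Z \<noteq> {}"
    by force
  then obtain s where "s \<in> {\<alpha><..\<beta>} - Z"
    by blast
  then have s: "\<alpha> < s" "s \<le> \<beta>" "s \<notin> Z"
    by auto
  have uniq: "x = s" if "\<alpha> < x" "x \<le> \<beta>" "x \<notin> Z" for x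
  proof (rule ccontr)
    assume "x \<noteq> s"
    \<comment> \<open>Two remaining points would be separated by a rational, and one of the removed intervals contains one of them.\<close>
    define y z where "y = min x s" and "z = max x s"
    have yz: "y < z" "\<alpha> < y" "z \<le> \<beta>" "y \<notin> Z" "z \<notin> Z"
      using \<open>x \<noteq> s\<close> s that by (auto simp: y_def z_def min_def max_def)
    obtain q where "q \<in> \<rat>" "y < q" "q < z"
      using Rats_dense_in_real[OF \<open>y < z\<close>] by auto
    then show False
      using Q01[of q] yz by (fastforce simp: Z_def)
  qed
  have eq: "emeasure \<tau> G = indicator G s" if G: "G \<in> sets borel" "G \<subseteq> {\<alpha><..\<beta>}" for G
  proof (cases "s \<in> G")
    case True
    have "x \<in> {\<alpha><..\<beta>} - Z \<longleftrightarrow> x = s" for x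
      using s uniq[of x] by auto
    then have "{\<alpha><..\<beta>} - Z = {s}"
      by blast
    then have 1: "emeasure \<tau> {s} = 1"
      using \<open>emeasure \<tau> ({\<alpha><..\<beta>} - Z) = 1\<close> by simp
    have "emeasure \<tau> {s} \<le> emeasure \<tau> G" "emeasure \<tau> G \<le> emeasure \<tau> {\<alpha><..\<beta>}"
      using True G by (auto intro!: emeasure_mono)
    then show ?thesis
      using True 1 unit by simp
  next
    case False
    have "x \<in> Z" if "x \<in> G" for x
      using uniq[of x] subsetD[OF G(2) that] False that by auto
    then have "G \<subseteq> Z"
      by blast
    then have "emeasure \<tau> G \<le> emeasure \<tau> Z"
      using Z by (intro emeasure_mono) auto
    then have "emeasure \<tau> G \<le> 0"
      using Z by (auto simp: null_sets_def)
    then show ?thesis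
      using False by simp
  qed
  show ?thesis
    using that[OF s(1,2) eq] by blast
qed

section \<open>Left limits\<close>

lemma left_limit_eqI: "(f \<longlongrightarrow> l) (at_left s) \<Longrightarrow> left_limit f s = l"
  unfolding left_limit_def by (rule tendsto_Lim) auto

text \<open>The left limit is the limit of \<open>f\<close> along the grid points \<open>(\<lceil>k s\<rceil> - 1) / k\<close>, which lie
strictly below \<open>s\<close> and tend to it. Each approximation depends on \<open>s\<close> only through an
integer valued measurable function, and is therefore measurable.\<close>

lemma measurable_left_limit:
  assumes lim: "\<And>s. 0 < s \<Longrightarrow> \<exists>l. (f \<longlongrightarrow> l) (at_left s)"
  shows "(\<lambda>s. if 0 < s then left_limit f s else 0) \<in> borel_measurable borel"
proof (rule borel_measurable_LIMSEQ_real)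
  define p where "p k s = (real_of_int \<lceil>real (Suc k) * s\<rceil> - 1) / real (Suc k)" for k s
  show "(\<lambda>s. if 0 < s then f (p k s) else 0) \<in> borel_measurable borel" for k
  proof -
    have 1: "(\<lambda>s::real. \<lceil>real (Suc k) * s\<rceil>) \<in> measurable borel (count_space UNIV)"
      by measurable
    have "(\<lambda>s. f (p k s)) \<in> borel_measurable borel"
      using measurable_compose[OF 1, of "\<lambda>z. f ((real_of_int z - 1) / real (Suc k))" borel]
      by (simp add: p_def)
    then show ?thesis by measurable
  qed
  show "(\<lambda>k. if 0 < s then f (p k s) else 0) \<longlonglongrightarrow> (if 0 < s then left_limit f s else 0)" for s
  proof (cases "0 < s")
    case True
    then obtain l where l: "(f \<longlongrightarrow> l) (at_left s)"
      using lim by auto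
    have less: "p k s < s" for k
    proof -
      have "real_of_int \<lceil>real (Suc k) * s\<rceil> - 1 < real (Suc k) * s"
        by linarith
      then show ?thesis by (simp add: p_def field_simps)
    qed
    have ge: "s - 1 / real (Suc k) \<le> p k s" for k
    proof -
      have "real (Suc k) * s - 1 \<le> real_of_int \<lceil>real (Suc k) * s\<rceil> - 1"
        by linarith
      then have "(real (Suc k) * s - 1) / real (Suc k) \<le> p k s"
        unfolding p_def by (intro divide_right_mono) auto
      then show ?thesis by (simp add: diff_divide_distrib)
    qed
    have "(\<lambda>k. s - 1 / real (Suc k)) \<longlonglongrightarrow> s - 0"
      by (intro tendsto_intros LIMSEQ_Suc[OF lim_1_over_n])
    then have "(\<lambda>k. p k s) \<longlonglongrightarrow> s"
      using less ge by (intro tendsto_sandwich[of "\<lambda>k. s - 1 / real (Suc k)" "\<lambda>k. p k s" _ "\<lambda>_. s"])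
        (auto intro!: less_imp_le always_eventually)
    then have "filterlim (\<lambda>k. p k s) (at_left s) sequentially"
      using less by (auto simp: filterlim_at less_imp_neq)
    then have "(\<lambda>k. f (p k s)) \<longlonglongrightarrow> l"
      by (rule filterlim_compose[OF l])
    then show ?thesis
      using True left_limit_eqI[OF l] by simp
  qed simp
qed

section \<open>Particles moving between gaps\<close>

definition gap_states :: "nat \<Rightarrow> (nat \<Rightarrow> nat) set" where
  "gap_states n = (\<Pi>\<^sub>E i\<in>{1..n}. UNIV)"

definition sources :: "nat \<Rightarrow> (nat + nat) set" where
  "sources n = {1..n} <+> {1..n}"

text \<open>Adding a particle to box \<open>n + 1\<close>, the reservoir, changes nothing, because the state is
restricted to the boxes \<open>1, \<dots>, n\<close>. This lets every move be written uniformly as passing from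
\<open>add_unit n (i + 1) g\<close> to \<open>add_unit n i g\<close> or back, including \<open>i = n\<close>.\<close>

definition add_unit :: "nat \<Rightarrow> nat \<Rightarrow> (nat \<Rightarrow> nat) \<Rightarrow> nat \<Rightarrow> nat" where
  "add_unit n i g = restrict (g(i := Suc (g i))) {1..n}"

text \<open>The source \<open>Inl i\<close> is the arrival stream of queue \<open>i\<close> and \<open>Inr i\<close> its departure stream.\<close>

fun move :: "nat \<Rightarrow> nat + nat \<Rightarrow> (nat \<Rightarrow> nat) \<Rightarrow> nat \<Rightarrow> nat" where
  "move n (Inl i) g =
    (if i = n \<or> 0 < g (i + 1) then restrict (g(i + 1 := g (i + 1) - 1, i := Suc (g i))) {1..n} else g)"
| "move n (Inr i) g =
    (if 0 < g i then restrict (g(i := g i - 1, i + 1 := Suc (g (i + 1)))) {1..n} else g)"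

definition slot_move :: "nat \<Rightarrow> (nat + nat) option \<Rightarrow> (nat \<Rightarrow> nat) \<Rightarrow> nat \<Rightarrow> nat" where
  "slot_move n q g = (case q of None \<Rightarrow> g | Some j \<Rightarrow> move n j g)"

definition queue_length :: "(nat \<Rightarrow> nat) \<Rightarrow> nat \<Rightarrow> real" where
  "queue_length g i = (\<Sum>k=1..i. real (g k))"

lemma sources_simps [simp]:
  "Inl i \<in> sources n \<longleftrightarrow> i \<in> {1..n}" "Inr i \<in> sources n \<longleftrightarrow> i \<in> {1..n}" "finite (sources n)"
  by (auto simp: sources_def)

lemma restrict_gap_states [simp]: "restrict g {Suc 0..n} \<in> gap_states n"
  by (auto simp: gap_states_def)

lemma gap_states_eqI: "g \<in> gap_states n \<Longrightarrow> g' \<in> gap_states n \<Longrightarrow> (\<And>i. i \<in> {1..n} \<Longrightarrow> g i = g' i) \<Longrightarrow> g = g'"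
  unfolding gap_states_def by (rule PiE_ext)

lemma add_unit_states [simp]: "add_unit n i g \<in> gap_states n"
  by (simp add: add_unit_def)

lemma add_unit_reservoir [simp]: "g \<in> gap_states n \<Longrightarrow> add_unit n (Suc n) g = g"
  by (rule gap_states_eqI) (auto simp: add_unit_def)

lemma move_states: "g \<in> gap_states n \<Longrightarrow> move n j g \<in> gap_states n"
  by (cases j) auto

lemma slot_move_states: "g \<in> gap_states n \<Longrightarrow> slot_move n q g \<in> gap_states n"
  by (auto simp: slot_move_def move_states split: option.split)

lemma fold_slot_move_states: "g \<in> gap_states n \<Longrightarrow> fold (slot_move n) W g \<in> gap_states n"
  by (induction W arbitrary: g) (auto simp: slot_move_states)

lemma move_add_unit:
  assumes "g \<in> gap_states n" "i \<in> {1..n}"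
  shows "move n (Inl i) (add_unit n (Suc i) g) = add_unit n i g"
    and "move n (Inr i) (add_unit n i g) = add_unit n (Suc i) g"
  using assms by (auto intro!: gap_states_eqI[of _ n] simp: add_unit_def)

lemma inj_add_unit: "inj_on (add_unit n i) (gap_states n)"
proof (rule inj_onI)
  fix g g' assume *: "g \<in> gap_states n" "g' \<in> gap_states n" "add_unit n i g = add_unit n i g'"
  show "g = g'"
  proof (rule gap_states_eqI[OF *(1,2)])
    fix k assume "k \<in> {1..n}"
    then show "g k = g' k"
      using fun_cong[OF *(3), of k] by (auto simp: add_unit_def split: if_splits)
  qed
qed

lemma range_add_unit:
  assumes "i \<in> {1..Suc n}"
  shows "add_unit n i ` gap_states n = {g \<in> gap_states n. i = Suc n \<or> 0 < g i}"
proof (intro equalityI subsetI)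
  fix g assume g: "g \<in> {g \<in> gap_states n. i = Suc n \<or> 0 < g i}"
  then have "g = add_unit n i (restrict (g(i := g i - 1)) {1..n})"
    by (intro gap_states_eqI[of _ n]) (use assms in \<open>auto simp: add_unit_def\<close>)
  then show "g \<in> add_unit n i ` gap_states n"
    using imageI[of "restrict (g(i := g i - 1)) {1..n}" "gap_states n" "add_unit n i"] by simp
qed (use assms in \<open>auto simp: add_unit_def split: if_splits\<close>)

lemma queue_length_add_unit:
  assumes "k \<in> {1..Suc n}" "i \<le> n"
  shows "queue_length (add_unit n k g) i = queue_length g i + of_bool (k \<le> i)"
  using assms(2)
proof (induction i)
  case (Suc i)
  then show ?case
    using assms(1) by (auto simp: queue_length_def add_unit_def)
qed (use assms in \<open>simp add: queue_length_def\<close>)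

lemma queue_length_Suc: "queue_length g (Suc i) = queue_length g i + real (g (Suc i))"
  by (simp add: queue_length_def)

text \<open>In terms of queue lengths the moves are the jumps prescribed by the integral equations: an
empty box means that two neighbouring queues have equal length.\<close>

lemma queue_length_move:
  assumes g: "g \<in> gap_states n" and i: "i \<in> {1..n}" "i' \<le> n"
  shows "queue_length (move n (Inl i) g) i' = queue_length g i' +
      of_bool (i' = i \<and> (i = n \<or> queue_length g i < queue_length g (Suc i)))"
    and "queue_length (move n (Inr i) g) i' = queue_length g i' -
      of_bool (i' = i \<and> queue_length g (i - 1) < queue_length g i)"
proof -
  show "queue_length (move n (Inl i) g) i' = queue_length g i' +
      of_bool (i' = i \<and> (i = n \<or> queue_length g i < queue_length g (Suc i)))"
  proof (cases "i = n \<or> 0 < g (Suc i)")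
    case True
    then have "g \<in> add_unit n (Suc i) ` gap_states n"
      using g i by (subst range_add_unit) auto
    then obtain g0 where g0: "g0 \<in> gap_states n" "g = add_unit n (Suc i) g0"
      by auto
    have "queue_length (move n (Inl i) g) i' = queue_length g i' + of_bool (i' = i)"
      unfolding g0(2) move_add_unit(1)[OF g0(1) i(1)] using i
      by (auto simp: queue_length_add_unit)
    then show ?thesis using True by (simp add: queue_length_Suc)
  next
    case False
    then show ?thesis by (simp add: queue_length_Suc)
  qed
  obtain k where k: "i = Suc k"
    using i by (cases i) auto
  show "queue_length (move n (Inr i) g) i' = queue_length g i' -
      of_bool (i' = i \<and> queue_length g (i - 1) < queue_length g i)"
  proof (cases "0 < g i")
    case True
    then have "g \<in> add_unit n i ` gap_states n"
      using g i by (subst range_add_unit) auto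
    then obtain g0 where g0: "g0 \<in> gap_states n" "g = add_unit n i g0"
      by auto
    have "queue_length (move n (Inr i) g) i' = queue_length g i' - of_bool (i' = i)"
      unfolding g0(2) move_add_unit(2)[OF g0(1) i(1)] using i
      by (auto simp: queue_length_add_unit)
    then show ?thesis using True by (simp add: queue_length_Suc k)
  next
    case False
    then show ?thesis by (simp add: queue_length_Suc k)
  qed
qed

section \<open>Paths driven by at most one point per slot\<close>

text \<open>The times at which a point of source \<open>j\<close> acts on the queues \<open>y\<close>, as opposed to falling into a pause.\<close>

definition open_times :: "nat \<Rightarrow> (nat \<Rightarrow> real \<Rightarrow> real) \<Rightarrow> nat + nat \<Rightarrow> real set" where
  "open_times n y j = (case j of
      Inl i \<Rightarrow> {s. i = n \<or> left_limit (y i) s < left_limit (y (i + 1)) s}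
    | Inr i \<Rightarrow> {s. left_limit (y (i - 1)) s < left_limit (y i) s})"

lemma open_times_measurable:
  assumes lim: "\<And>i s. i \<le> n \<Longrightarrow> 0 < s \<Longrightarrow> \<exists>l. (y i \<longlongrightarrow> l) (at_left s)"
    and j: "j \<in> sources n"
  shows "{0<..} \<inter> open_times n y j \<in> sets borel"
proof -
  define L where "L i s = (if 0 < s then left_limit (y i) s else 0)" for i s
  have L: "L i \<in> borel_measurable borel" if "i \<le> n" for i
    unfolding L_def[abs_def] by (rule measurable_left_limit) (use lim that in auto)
  have less: "{s. L i s < L i' s} \<in> sets borel" if "i \<le> n" "i' \<le> n" for i i'
    using L[OF that(1)] L[OF that(2)] by measurable
  show ?thesis
  proof (cases j)
    case (Inl i)
    show ?thesis
    proof (cases "i = n")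
      case False
      then have "{0<..} \<inter> open_times n y j = {0<..} \<inter> {s. L i s < L (Suc i) s}"
        by (auto simp: open_times_def Inl L_def)
      then show ?thesis
        using less[of i "Suc i"] j False by (auto simp: Inl)
    qed (auto simp: open_times_def Inl)
  next
    case (Inr i)
    have "{0<..} \<inter> open_times n y j = {0<..} \<inter> {s. L (i - 1) s < L i s}"
      by (auto simp: open_times_def Inr L_def)
    moreover have "i - 1 \<le> n" "i \<le> n"
      using j by (auto simp: Inr)
    then have "{s. L (i - 1) s < L i s} \<in> sets borel"
      by (rule less)
    ultimately show ?thesis
      by (simp add: sets.Int)
  qed
qed

text \<open>Until the single point of the slot, at time \<open>u\<close>, no integral changes, so the left limits at
\<open>u\<close> are the queue lengths at the start of the slot. They decide whether the point acts, and the integral of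
its source then jumps by one at \<open>u\<close>.\<close>

lemma slot_step:
  fixes y :: "nat \<Rightarrow> real \<Rightarrow> real" and \<tau> :: "nat + nat \<Rightarrow> real measure"
  assumes "\<alpha> \<le> \<beta>" and "0 \<le> \<alpha>"
    and sets_\<tau>: "\<And>j. j \<in> sources n \<Longrightarrow> sets (\<tau> j) = sets borel"
    and open_times: "\<And>j. j \<in> sources n \<Longrightarrow> {0<..} \<inter> open_times n y j \<in> sets borel"
    and y0: "\<And>s. s \<in> {\<alpha>..\<beta>} \<Longrightarrow> y 0 s = 0"
    and y: "\<And>i s. i \<in> {1..n} \<Longrightarrow> s \<in> {\<alpha>..\<beta>} \<Longrightarrow> y i s = y i \<alpha>
      + measure (\<tau> (Inl i)) ({\<alpha><..s} \<inter> open_times n y (Inl i))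
      - measure (\<tau> (Inr i)) ({\<alpha><..s} \<inter> open_times n y (Inr i))"
    and count: "\<And>j. j \<in> sources n \<Longrightarrow> emeasure (\<tau> j) {\<alpha><..\<beta>} = of_bool (q = Some j)"
    and q: "\<And>j. q = Some j \<Longrightarrow> j \<in> sources n"
    and natural: "\<And>j r. j \<in> sources n \<Longrightarrow> r \<in> \<rat> \<Longrightarrow> \<alpha> < r \<Longrightarrow> r < \<beta> \<Longrightarrow>
      \<exists>k::nat. emeasure (\<tau> j) {\<alpha><..r} = of_nat k"
    and g: "g \<in> gap_states n"
    and start: "\<And>i. i \<le> n \<Longrightarrow> y i \<alpha> = queue_length g i"
    and i: "i \<le> n"
  shows "y i \<beta> = queue_length (slot_move n q g) i"
proof -
  have quiet: "measure (\<tau> j) ({\<alpha><..s} \<inter> T) = 0"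
    if "j \<in> sources n" "q \<noteq> Some j" "s \<le> \<beta>" for j s T
  proof -
    have "emeasure (\<tau> j) ({\<alpha><..s} \<inter> T) \<le> emeasure (\<tau> j) {\<alpha><..\<beta>}"
      using that by (intro emeasure_mono) (auto simp: sets_\<tau>)
    then show ?thesis
      using count[OF that(1)] that by (simp add: measure_def)
  qed
  show ?thesis
  proof (cases q)
    case None
    have "y i \<beta> = y i \<alpha>"
    proof (cases "i = 0")
      case False
      then show ?thesis
        using y[of i \<beta>] quiet[of "Inl i" \<beta>] quiet[of "Inr i" \<beta>] i None \<open>\<alpha> \<le> \<beta>\<close> by simp
    qed (use y0 \<open>\<alpha> \<le> \<beta>\<close> in simp)
    then show ?thesis
      using start i by (simp add: None slot_move_def)
  next
    case (Some j)
    then have j: "j \<in> sources n"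
      using q by simp
    obtain u where u: "\<alpha> < u" "u \<le> \<beta>"
      and atom: "\<And>G. G \<in> sets borel \<Longrightarrow> G \<subseteq> {\<alpha><..\<beta>} \<Longrightarrow> emeasure (\<tau> j) G = indicator G u"
      using unit_atom[OF sets_\<tau>[OF j], of \<alpha> \<beta>] count[OF j] natural[OF j] Some by auto
    have atom_open: "measure (\<tau> j) ({\<alpha><..s} \<inter> open_times n y j) = of_bool (u \<le> s \<and> u \<in> open_times n y j)"
      if "s \<le> \<beta>" for s
    proof -
      have "{\<alpha><..s} \<inter> open_times n y j = {\<alpha><..s} \<inter> ({0<..} \<inter> open_times n y j)"
        using \<open>0 \<le> \<alpha>\<close> by auto
      then have "{\<alpha><..s} \<inter> open_times n y j \<in> sets borel"
        using open_times[OF j] by auto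
      then have "emeasure (\<tau> j) ({\<alpha><..s} \<inter> open_times n y j) =
          indicator ({\<alpha><..s} \<inter> open_times n y j) u"
        using that by (intro atom) auto
      then show ?thesis
        using u by (auto simp: measure_def indicator_def)
    qed
    have before: "y k s = queue_length g k" if k: "k \<le> n" and s: "\<alpha> \<le> s" "s < u" for k s
    proof (cases "k = 0")
      case True
      then show ?thesis
        using y0[of s] s u by (simp add: queue_length_def)
    next
      case False
      then have k': "k \<in> {1..n}" using k by auto
      have "measure (\<tau> j') ({\<alpha><..s} \<inter> open_times n y j') = 0" if "j' \<in> sources n" for j'
        using quiet[of j' s] atom_open[of s] that s u Some by (cases "j' = j") auto
      then have "y k s = y k \<alpha>"
        using y[OF k', of s] k' s u by simp
      then show ?thesis
        using start k by simp
    qed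
    have left: "left_limit (y k) u = queue_length g k" if k: "k \<le> n" for k
    proof (rule left_limit_eqI, rule tendsto_eventually)
      show "\<forall>\<^sub>F s in at_left u. y k s = queue_length g k"
        using before[OF k] u by (auto simp: eventually_at_left_field intro!: exI[of _ \<alpha>])
    qed
    have final: "measure (\<tau> j') ({\<alpha><..\<beta>} \<inter> open_times n y j') =
        of_bool (j' = j \<and> u \<in> open_times n y j')" if "j' \<in> sources n" for j'
    proof (cases "j' = j")
      case True
      then show ?thesis
        using atom_open[of \<beta>] u by simp
    qed (use quiet[OF that, of \<beta>] Some in simp)
    have jump: "y i \<beta> = y i \<alpha> + of_bool (j = Inl i \<and> u \<in> open_times n y j)
        - of_bool (j = Inr i \<and> u \<in> open_times n y j)" if "0 < i"
      using y[of i \<beta>] final[of "Inl i"] final[of "Inr i"] i that \<open>\<alpha> \<le> \<beta>\<close> by auto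
    show ?thesis
    proof (cases "i = 0")
      case True
      then show ?thesis
        using y0 \<open>\<alpha> \<le> \<beta>\<close> by (simp add: queue_length_def)
    next
      case False
      show ?thesis
      proof (cases j)
        case (Inl k)
        then have k: "k \<in> {1..n}" using j by simp
        have "u \<in> open_times n y (Inl k) \<longleftrightarrow> k = n \<or> queue_length g k < queue_length g (Suc k)"
          using k left[of k] left[of "Suc k"] by (cases "k = n") (auto simp: open_times_def)
        then show ?thesis
          using jump False start[OF i] queue_length_move(1)[OF g k i]
          by (simp add: Some Inl slot_move_def eq_commute[of k] del: move.simps)
      next
        case (Inr k)
        then have k: "k \<in> {1..n}" using j by simp
        have "u \<in> open_times n y (Inr k) \<longleftrightarrow> queue_length g (k - 1) < queue_length g k"
          using k left[of k] left[of "k - 1"] by (auto simp: open_times_def)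
        then show ?thesis
          using jump False start[OF i] queue_length_move(2)[OF g k i]
          by (simp add: Some Inr slot_move_def eq_commute[of k] del: move.simps)
      qed
    qed
  qed
qed

definition slot_symbols :: "nat \<Rightarrow> (nat + nat) option set" where
  "slot_symbols n = insert None (Some ` sources n)"

text \<open>A letter of the word \<open>W\<close> prescribes the content of a slot: \<open>None\<close> stands for no
point at all, \<open>Some j\<close> for exactly one point, belonging to source \<open>j\<close>.\<close>

lemma path_follows_word:
  fixes y :: "nat \<Rightarrow> real \<Rightarrow> real" and \<tau> :: "nat + nat \<Rightarrow> real measure" and h :: real
  assumes "0 \<le> h" and W: "set W \<subseteq> slot_symbols n"
    and sets_\<tau>: "\<And>j. j \<in> sources n \<Longrightarrow> sets (\<tau> j) = sets borel"
    and open_times: "\<And>j. j \<in> sources n \<Longrightarrow> {0<..} \<inter> open_times n y j \<in> sets borel"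
    and y0: "\<And>s. 0 \<le> s \<Longrightarrow> y 0 s = 0"
    and y: "\<And>i s. i \<in> {1..n} \<Longrightarrow> 0 \<le> s \<Longrightarrow> y i s = queue_length g i
      + measure (\<tau> (Inl i)) ({0<..s} \<inter> open_times n y (Inl i))
      - measure (\<tau> (Inr i)) ({0<..s} \<inter> open_times n y (Inr i))"
    and fin: "\<And>j. j \<in> sources n \<Longrightarrow> emeasure (\<tau> j) {0<..real (length W) * h} < \<infinity>"
    and count: "\<And>j k. j \<in> sources n \<Longrightarrow> k < length W \<Longrightarrow>
      emeasure (\<tau> j) {real k * h<..real (Suc k) * h} = of_bool (W ! k = Some j)"
    and natural: "\<And>j k r. j \<in> sources n \<Longrightarrow> k < length W \<Longrightarrow> r \<in> \<rat> \<Longrightarrow> real k * h < r \<Longrightarrow>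
      \<exists>l::nat. emeasure (\<tau> j) {real k * h<..r} = of_nat l"
    and g: "g \<in> gap_states n"
    and i: "i \<le> n"
  shows "y i (real (length W) * h) = queue_length (fold (slot_move n) W g) i"
proof -
  have "y i (real k * h) = queue_length (fold (slot_move n) (take k W) g) i"
    if "k \<le> length W" "i \<le> n" for k i
    using that
  proof (induction k arbitrary: i)
    case 0
    then show ?case
      using y0[of 0] y[of i 0] by (cases "i = 0") (auto simp: queue_length_def)
  next
    case (Suc k)
    have kh: "real k * h \<le> real (Suc k) * h" "0 \<le> real k * h"
      using \<open>0 \<le> h\<close> by (auto simp: mult_right_mono)
    have mh: "real (Suc k) * h \<le> real (length W) * h"
      using \<open>0 \<le> h\<close> Suc.prems by (intro mult_right_mono) auto
    have split: "measure (\<tau> j) ({0<..s} \<inter> open_times n y j) =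
        measure (\<tau> j) ({0<..real k * h} \<inter> open_times n y j) +
        measure (\<tau> j) ({real k * h<..s} \<inter> open_times n y j)"
      if j: "j \<in> sources n" and s: "real k * h \<le> s" "s \<le> real (Suc k) * h" for j s
    proof -
      have meas: "{\<alpha><..s} \<inter> open_times n y j \<in> sets (\<tau> j)" if "0 \<le> \<alpha>" for \<alpha> s
      proof -
        have "{\<alpha><..s} \<inter> open_times n y j = {\<alpha><..s} \<inter> ({0<..} \<inter> open_times n y j)"
          using that by auto
        then show ?thesis
          using open_times[OF j] by (auto simp: sets_\<tau>[OF j])
      qed
      have finite: "emeasure (\<tau> j) ({\<alpha><..s'} \<inter> open_times n y j) \<noteq> \<infinity>" if "0 \<le> \<alpha>" "s' \<le> s" for \<alpha> s'
      proof -
        have "emeasure (\<tau> j) ({\<alpha><..s'} \<inter> open_times n y j) \<le> emeasure (\<tau> j) {0<..real (length W) * h}"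
          using that s mh by (intro emeasure_mono) (auto simp: sets_\<tau>[OF j])
        then show ?thesis using fin[OF j] by auto
      qed
      have "{0<..s} \<inter> open_times n y j =
          ({0<..real k * h} \<inter> open_times n y j) \<union> ({real k * h<..s} \<inter> open_times n y j)"
        using s kh by auto
      also have "measure (\<tau> j) \<dots> = measure (\<tau> j) ({0<..real k * h} \<inter> open_times n y j) +
          measure (\<tau> j) ({real k * h<..s} \<inter> open_times n y j)"
        using s kh by (intro measure_Union finite meas) auto
      finally show ?thesis .
    qed
    have "y i (real (Suc k) * h) =
        queue_length (slot_move n (W ! k) (fold (slot_move n) (take k W) g)) i"
    proof (rule slot_step[where \<tau> = \<tau>, OF kh sets_\<tau> open_times])
      show "y i s = y i (real k * h)
        + measure (\<tau> (Inl i)) ({real k * h<..s} \<inter> open_times n y (Inl i))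
        - measure (\<tau> (Inr i)) ({real k * h<..s} \<inter> open_times n y (Inr i))"
        if "i \<in> {1..n}" "s \<in> {real k * h..real (Suc k) * h}" for i s
        using y[OF that(1), of s] y[OF that(1), of "real k * h"]
          split[of "Inl i" s] split[of "Inr i" s] that kh by simp
      show "j \<in> sources n" if "W ! k = Some j" for j
        using W nth_mem[of k W] Suc.prems that by (auto simp: slot_symbols_def)
    qed (use Suc y0 kh count natural g in \<open>auto intro: fold_slot_move_states\<close>)
    also have "slot_move n (W ! k) (fold (slot_move n) (take k W) g) =
        fold (slot_move n) (take (Suc k) W) g"
      using Suc.prems by (simp add: take_Suc_conv_app_nth)
    finally show ?case .
  qed
  from this[of "length W" i] show ?thesis using i by simp
qed

section \<open>A lower bound for the transition probabilities\<close>

definition source_rate :: "real \<Rightarrow> real \<Rightarrow> nat \<Rightarrow> nat + nat \<Rightarrow> real" where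
  "source_rate a b n = case_sum (arrival_rate a b n) (\<lambda>_. real n)"

definition total_rate :: "real \<Rightarrow> real \<Rightarrow> nat \<Rightarrow> real" where
  "total_rate a b n = (\<Sum>j\<in>sources n. source_rate a b n j)"

text \<open>The probability that a slot of length \<open>h\<close> has the content \<open>q\<close>: the Poisson weights
\<open>exp (- h \<lambda>)\<close> and \<open>h \<lambda> exp (- h \<lambda>)\<close>, multiplied over all sources.\<close>

definition slot_weight :: "real \<Rightarrow> real \<Rightarrow> nat \<Rightarrow> real \<Rightarrow> (nat + nat) option \<Rightarrow> real" where
  "slot_weight a b n h q = exp (- (h * total_rate a b n)) *
     (case q of None \<Rightarrow> 1 | Some j \<Rightarrow> h * source_rate a b n j)"

definition words :: "nat \<Rightarrow> nat \<Rightarrow> (nat + nat) option list set" where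
  "words n m = {W. set W \<subseteq> slot_symbols n \<and> length W = m}"

definition word_weight :: "real \<Rightarrow> real \<Rightarrow> nat \<Rightarrow> real \<Rightarrow> (nat + nat) option list \<Rightarrow> real" where
  "word_weight a b n h W = prod_list (map (slot_weight a b n h) W)"

definition scale_gaps :: "nat \<Rightarrow> (nat \<Rightarrow> nat) \<Rightarrow> nat \<Rightarrow> real" where
  "scale_gaps n g = (\<lambda>i\<in>{1..n}. real (g i) / sqrt (real n))"

lemma finite_slot_symbols [simp]: "finite (slot_symbols n)"
  by (simp add: slot_symbols_def)

lemma finite_words [simp]: "finite (words n m)"
  unfolding words_def by (rule finite_lists_length_eq) simp

lemma countable_gap_space: "countable (gap_space n)"
  unfolding gap_space_def by (rule countable_PiE) auto

lemma queues_of_scaled_gaps: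
  assumes "0 < n" "i \<le> n"
  shows "queues_of_gaps n (scale_gaps n g) i = queue_length g i"
  using assms by (auto simp: queues_of_gaps_def scale_gaps_def queue_length_def intro!: sum.cong)

lemma ordered_initial_queues:
  assumes "0 < n"
  shows "ordered_initial n (queues_of_gaps n (scale_gaps n g))"
proof -
  have "queue_length g i \<in> \<nat>" for i
    unfolding queue_length_def of_nat_sum[symmetric] by (rule of_nat_in_Nats)
  moreover have "queue_length g i \<le> queue_length g i'" if "i \<le> i'" for i i'
    using that unfolding queue_length_def by (intro sum_mono2) auto
  ultimately show ?thesis
    using assms by (auto simp: ordered_initial_def queues_of_scaled_gaps intro!: mono_onI)
qed

lemma scaled_gaps_queue_length:
  assumes "\<And>i. i \<le> n \<Longrightarrow> y i = queue_length g i"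
  shows "scaled_gaps n y = scale_gaps n g"
proof
  fix i
  show "scaled_gaps n y i = scale_gaps n g i"
  proof (cases "i \<in> {1..n}")
    case True
    then obtain k where "i = Suc k" by (cases i) auto
    then show ?thesis
      using True assms by (simp add: scaled_gaps_def scale_gaps_def queue_length_Suc)
  qed (auto simp: scaled_gaps_def scale_gaps_def)
qed

lemma scaled_gaps_event_sets:
  assumes Z: "\<And>i. i \<in> {0..n} \<Longrightarrow> Z i \<in> borel_measurable M" and B: "B \<subseteq> gap_space n"
  shows "{\<omega> \<in> space M. scaled_gaps n (\<lambda>i. Z i \<omega>) \<in> B} \<in> sets M"
proof -
  have "{\<omega> \<in> space M. scaled_gaps n (\<lambda>i. Z i \<omega>) \<in> B} =
      (\<Union>u\<in>B. {\<omega> \<in> space M. \<forall>i\<in>{1..n}. (Z i \<omega> - Z (i - 1) \<omega>) / sqrt (real n) = u i})"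
  proof (intro set_eqI iffI)
    fix \<omega> assume "\<omega> \<in> (\<Union>u\<in>B. {\<omega> \<in> space M. \<forall>i\<in>{1..n}. (Z i \<omega> - Z (i - 1) \<omega>) / sqrt (real n) = u i})"
    then obtain u where u: "u \<in> B" "\<omega> \<in> space M"
        "\<And>i. i \<in> {1..n} \<Longrightarrow> (Z i \<omega> - Z (i - 1) \<omega>) / sqrt (real n) = u i"
      by auto
    have "scaled_gaps n (\<lambda>i. Z i \<omega>) i = u i" for i
      using u B by (auto simp: scaled_gaps_def gap_space_def PiE_def extensional_def)
    then have "scaled_gaps n (\<lambda>i. Z i \<omega>) = u" ..
    then show "\<omega> \<in> {\<omega> \<in> space M. scaled_gaps n (\<lambda>i. Z i \<omega>) \<in> B}"
      using u by simp
  next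
    fix \<omega> assume "\<omega> \<in> {\<omega> \<in> space M. scaled_gaps n (\<lambda>i. Z i \<omega>) \<in> B}"
    then show "\<omega> \<in> (\<Union>u\<in>B. {\<omega> \<in> space M. \<forall>i\<in>{1..n}. (Z i \<omega> - Z (i - 1) \<omega>) / sqrt (real n) = u i})"
      by (intro UN_I[of "scaled_gaps n (\<lambda>i. Z i \<omega>)"]) (auto simp: scaled_gaps_def)
  qed
  moreover have "{\<omega> \<in> space M. \<forall>i\<in>{1..n}. (Z i \<omega> - Z (i - 1) \<omega>) / sqrt (real n) = u i} \<in> sets M" for u
  proof (rule sets.sets_Collect_finite_All)
    fix i assume "i \<in> {1..n}"
    then have [measurable]: "Z i \<in> borel_measurable M" "Z (i - 1) \<in> borel_measurable M"
      using Z by auto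
    show "{\<omega> \<in> space M. (Z i \<omega> - Z (i - 1) \<omega>) / sqrt (real n) = u i} \<in> sets M"
      by measurable
  qed simp
  moreover have "countable B"
    using B countable_gap_space by (rule countable_subset)
  ultimately show ?thesis
    by auto
qed

lemma scale_gaps_in_gap_space: "scale_gaps n g \<in> gap_space n"
  by (auto simp: scale_gaps_def gap_space_def)

lemma prob_space_system: "system_with_pauses a b n M A D Y \<Longrightarrow> prob_space M"
  by (simp add: system_with_pauses_def)

context
  fixes a b h :: real and n m :: nat and M :: "'w measure"
    and A D :: "nat \<Rightarrow> 'w \<Rightarrow> (real \<times> real) measure"
    and Y :: "(nat \<Rightarrow> real) \<Rightarrow> nat \<Rightarrow> real \<Rightarrow> 'w \<Rightarrow> real"
  assumes sys: "system_with_pauses a b n M A D Y"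
    and n: "0 < n" and m: "0 < m" and h: "0 \<le> h"
    and rate: "\<And>j. j \<in> sources n \<Longrightarrow> 0 \<le> source_rate a b n j"
begin

interpretation prob_space M
  using sys by (rule prob_space_system)

definition slot_box :: "nat + nat \<Rightarrow> nat \<Rightarrow> (real \<times> real) set" where
  "slot_box j k = {real k * h<..real (Suc k) * h} \<times> {0..source_rate a b n j}"

definition word_event :: "(nat + nat) option list \<Rightarrow> 'w set" where
  "word_event W = {\<omega> \<in> space M. \<forall>j\<in>sources n. \<forall>k<m.
     emeasure (case_sum A D j \<omega>) (slot_box j k) = of_nat (of_bool (W ! k = Some j))}"

lemma sources_poisson: "j \<in> sources n \<Longrightarrow> poisson_random_measure M lebesgue_quadrant (case_sum A D j)"
  using sys by (auto simp: system_with_pauses_def sources_def)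

lemma slot_times: "0 \<le> real k * h" "real k * h \<le> real (Suc k) * h"
  using h by (auto simp: mult_right_mono)

lemma slot_box_sets: "slot_box j k \<in> sets lebesgue_quadrant"
  unfolding slot_box_def using slot_times(1)[of k]
  by (intro quadrant_rectangle_sets) (auto intro: order_trans less_imp_le)

lemma emeasure_slot_box:
  "j \<in> sources n \<Longrightarrow> emeasure lebesgue_quadrant (slot_box j k) = ennreal (h * source_rate a b n j)"
  unfolding slot_box_def using slot_times[of k] rate
  by (subst emeasure_quadrant_rectangle) (auto simp: algebra_simps)

lemma word_event_sets: "word_event W \<in> events"
proof -
  have "{\<omega> \<in> space M. \<forall>j\<in>sources n. \<forall>k\<in>{..<m}.
     emeasure (case_sum A D j \<omega>) (slot_box j k) = of_nat (of_bool (W ! k = Some j))} \<in> events"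
  proof (intro sets.sets_Collect_finite_All)
    fix j k assume j: "j \<in> sources n"
    have [measurable]: "(\<lambda>\<omega>. emeasure (case_sum A D j \<omega>) (slot_box j k)) \<in> borel_measurable M"
      by (rule poisson_random_measureD(2)[OF sources_poisson[OF j] slot_box_sets])
    show "{\<omega> \<in> space M. emeasure (case_sum A D j \<omega>) (slot_box j k) = of_nat (of_bool (W ! k = Some j))} \<in> events"
      by measurable
  qed auto
  then show ?thesis
    unfolding word_event_def Ball_def lessThan_iff .
qed

lemma prob_word_event:
  assumes W: "W \<in> words n m"
  shows "prob (word_event W) = word_weight a b n h W"
proof -
  have "prob (word_event W) = (\<Prod>j\<in>sources n. \<Prod>k<m.
      measure lebesgue_quadrant (slot_box j k) ^ of_bool (W ! k = Some j) / fact (of_bool (W ! k = Some j))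
        * exp (- measure lebesgue_quadrant (slot_box j k)))"
    unfolding word_event_def
  proof (rule indep_poisson_counts)
    show "sources n \<noteq> {}"
      using n by (auto simp: sources_def)
    show "indep_random_measures M lebesgue_quadrant (case_sum A D) (sources n)"
      using sys by (simp add: system_with_pauses_def sources_def)
    show "disjoint_family_on (slot_box j) {..<m}" for j
    proof -
      have "slot_box j k \<inter> slot_box j l = {}" if "k < l" for k l
      proof -
        have "real (Suc k) * h \<le> real l * h"
          using that h by (intro mult_right_mono) auto
        then show ?thesis by (auto simp: slot_box_def)
      qed
      then show ?thesis
        unfolding disjoint_family_on_def by (metis inf_commute nat_neq_iff)
    qed
  qed (use m sources_poisson slot_box_sets emeasure_slot_box prob_space_axioms in auto)
  also have "\<dots> = (\<Prod>j\<in>sources n. \<Prod>k<m.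
      (h * source_rate a b n j) ^ of_bool (W ! k = Some j) * exp (- (h * source_rate a b n j)))"
    using emeasure_slot_box rate h by (intro prod.cong) (auto simp: measure_def)
  also have "\<dots> = (\<Prod>k<m. \<Prod>j\<in>sources n.
      (h * source_rate a b n j) ^ of_bool (W ! k = Some j) * exp (- (h * source_rate a b n j)))"
    by (rule prod.swap)
  also have "\<dots> = (\<Prod>k<m. slot_weight a b n h (W ! k))"
  proof (rule prod.cong)
    fix k assume "k \<in> {..<m}"
    then have Wk: "W ! k \<in> slot_symbols n"
      using W nth_mem[of k W] by (auto simp: words_def)
    have "(\<Prod>j\<in>sources n. (h * source_rate a b n j) ^ of_bool (W ! k = Some j)) =
        (case W ! k of None \<Rightarrow> 1 | Some j \<Rightarrow> h * source_rate a b n j)"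
    proof (cases "W ! k")
      case (Some j)
      then have j: "j \<in> sources n"
        using Wk by (auto simp: slot_symbols_def)
      have "(\<Prod>i\<in>sources n. (h * source_rate a b n i) ^ of_bool (W ! k = Some i)) =
          (\<Prod>i\<in>sources n. if i = j then h * source_rate a b n j else 1)"
        using Some by (intro prod.cong) auto
      then show ?thesis
        using j Some by simp
    qed simp
    moreover have "(\<Prod>j\<in>sources n. exp (- (h * source_rate a b n j))) = exp (- (h * total_rate a b n))"
      by (simp add: exp_sum[symmetric] total_rate_def sum_negf sum_distrib_left)
    ultimately show "(\<Prod>j\<in>sources n. (h * source_rate a b n j) ^ of_bool (W ! k = Some j) *
        exp (- (h * source_rate a b n j))) = slot_weight a b n h (W ! k)"
      by (simp add: prod.distrib slot_weight_def mult.commute)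
  qed simp
  also have "\<dots> = word_weight a b n h W"
    using W by (simp add: word_weight_def words_def prod.list_conv_set_nth atLeast0LessThan)
  finally show ?thesis .
qed

lemma disjoint_word_events: "disjoint_family_on word_event (words n m)"
  unfolding disjoint_family_on_def
proof (intro ballI impI)
  fix V W assume VW: "V \<in> words n m" "W \<in> words n m" "V \<noteq> W"
  then obtain k where k: "k < m" "V ! k \<noteq> W ! k"
    by (auto simp: words_def list_eq_iff_nth_eq)
  moreover have "V ! k \<in> slot_symbols n" "W ! k \<in> slot_symbols n"
    using VW k nth_mem[of k V] nth_mem[of k W] by (auto simp: words_def)
  ultimately obtain j where j: "j \<in> sources n" "(V ! k = Some j) \<noteq> (W ! k = Some j)"
    by (auto simp: slot_symbols_def)
  then have neq: "(of_nat (of_bool (V ! k = Some j)) :: ennreal) \<noteq> of_nat (of_bool (W ! k = Some j))"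
    by (cases "V ! k = Some j") auto
  have count: "emeasure (case_sum A D j \<omega>) (slot_box j k) = of_nat (of_bool (X ! k = Some j))"
    if "\<omega> \<in> word_event X" for X \<omega>
    using that j(1) k(1) unfolding word_event_def by blast
  show "word_event V \<inter> word_event W = {}"
  proof (rule ccontr)
    assume "word_event V \<inter> word_event W \<noteq> {}"
    then obtain \<omega> where "\<omega> \<in> word_event V" "\<omega> \<in> word_event W"
      by blast
    from count[OF this(1)] count[OF this(2)] neq show False
      by metis
  qed
qed

text \<open>Almost every outcome satisfies the hypotheses of the pathwise statement: the integral
equations hold, no point that could act has time \<open>0\<close>, and all counts that matter are finite integers. Of these there are
countably many, one for each slot, source and rational right end.\<close>

lemma scaled_gaps_on_word_event:
  assumes W: "W \<in> words n m" and g: "g \<in> gap_states n"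
  shows "AE \<omega> in M. \<omega> \<in> word_event W \<longrightarrow>
    scaled_gaps n (\<lambda>i. Y (queues_of_gaps n (scale_gaps n g)) i (real m * h) \<omega>) =
    scale_gaps n (fold (slot_move n) W g)"
proof -
  define x where "x = queues_of_gaps n (scale_gaps n g)"
  define c where "c = source_rate a b n"
  have ranked: "ranked_queues a b n M A D x (Y x)"
    using sys ordered_initial_queues[OF n] by (simp add: system_with_pauses_def x_def)
  \<comment> \<open>The left limits at time 0 are arbitrary, so points at time 0 have to be excluded.\<close>
  have null: "AE \<omega> in M. \<forall>j\<in>sources n. emeasure (case_sum A D j \<omega>) ({0} \<times> {0..c j}) = 0"
  proof (intro AE_ball_countable[THEN iffD2] ballI)
    fix j assume j: "j \<in> sources n"
    show "AE \<omega> in M. emeasure (case_sum A D j \<omega>) ({0} \<times> {0..c j}) = 0"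
      using emeasure_quadrant_rectangle(2)[of 0 0 "c j"] rate[OF j]
      by (intro poisson_AE_null[OF prob_space_axioms sources_poisson[OF j]] quadrant_rectangle_sets)
        (auto simp: c_def)
  qed (simp add: countable_finite)
  have mh: "0 \<le> real m * h" using h by simp
  have finite: "AE \<omega> in M. \<forall>j\<in>sources n. emeasure (case_sum A D j \<omega>) ({0<..real m * h} \<times> {0..c j}) < \<infinity>"
  proof (intro AE_ball_countable[THEN iffD2] ballI)
    fix j assume j: "j \<in> sources n"
    have "AE \<omega> in M. \<exists>k::nat. emeasure (case_sum A D j \<omega>) ({0<..real m * h} \<times> {0..c j}) = of_nat k"
      using rate[OF j] mh emeasure_quadrant_rectangle(1)[of 0 "real m * h" "c j"]
      by (intro poisson_AE_finite_count[OF prob_space_axioms sources_poisson[OF j]] quadrant_rectangle_sets)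
        (auto simp: c_def)
    then show "AE \<omega> in M. emeasure (case_sum A D j \<omega>) ({0<..real m * h} \<times> {0..c j}) < \<infinity>"
      by eventually_elim (auto simp: of_nat_less_top)
  qed (simp add: countable_finite)
  have natural: "AE \<omega> in M. \<forall>j\<in>sources n. \<forall>k\<in>{..<m}. \<forall>r\<in>{r\<in>\<rat>. real k * h < r}.
      \<exists>l::nat. emeasure (case_sum A D j \<omega>) ({real k * h<..r} \<times> {0..c j}) = of_nat l"
  proof (intro AE_ball_countable[THEN iffD2] ballI)
    fix j k r assume j: "j \<in> sources n" and r: "r \<in> {r\<in>\<rat>. real k * h < r}"
    then show "AE \<omega> in M. \<exists>l::nat. emeasure (case_sum A D j \<omega>) ({real k * h<..r} \<times> {0..c j}) = of_nat l"
      using rate[OF j] slot_times(1)[of k] emeasure_quadrant_rectangle(1)[of "real k * h" r "c j"]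
      by (intro poisson_AE_finite_count[OF prob_space_axioms sources_poisson[OF j]] quadrant_rectangle_sets)
        (auto simp: c_def intro: order_trans less_imp_le)
  qed (auto intro: countable_finite countable_subset[OF _ countable_rat])
  have "AE \<omega> in M. \<omega> \<in> space M"
    by (rule AE_space)
  moreover note ranked[unfolded ranked_queues_def, THEN conjunct2] null finite natural
  ultimately show ?thesis
    unfolding x_def[symmetric]
  proof eventually_elim
    case (elim \<omega>)
    define \<tau> where "\<tau> j = time_marginal (c j) (case_sum A D j \<omega>)" for j
    define y where "y i s = Y x i s \<omega>" for i s
    have sets_N: "sets (case_sum A D j \<omega>) = sets lebesgue_quadrant" if "j \<in> sources n" for j
      by (rule poisson_random_measureD(1)[OF sources_poisson[OF that] elim(1)])
    have \<tau>: "emeasure (\<tau> j) G = emeasure (case_sum A D j \<omega>) (G \<times> {0..c j})"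
      if "j \<in> sources n" "G \<in> sets borel" "G \<subseteq> {0..}" for j G
      unfolding \<tau>_def by (rule emeasure_time_marginal[OF sets_N[OF that(1)] that(2,3)])
    have sets_\<tau>: "sets (\<tau> j) = sets borel" if "j \<in> sources n" for j
      by (simp add: \<tau>_def time_marginal_def)
    have y0: "y 0 s = 0" if "0 \<le> s" for s
      using elim(2) that by (simp add: y_def)
    have lim: "\<exists>l. (y i \<longlongrightarrow> l) (at_left s)" if "i \<le> n" "0 < s" for i s
    proof (cases "i = 0")
      case True
      have "\<forall>\<^sub>F u in at_left s. y 0 u = 0"
        using that y0 by (auto simp: eventually_at_left_field intro!: exI[of _ 0])
      then show ?thesis
        using True tendsto_eventually by blast
    next
      case False
      then have "cadlag (y i)"
        using elim(2) that by (simp add: y_def[abs_def])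
      then show ?thesis
        using that by (auto simp: cadlag_def)
    qed
    have open_times: "{0<..} \<inter> open_times n y j \<in> sets borel" if "j \<in> sources n" for j
      by (rule open_times_measurable[OF lim that])
    have split: "{0..s} \<inter> open_times n y j =
        ({0} \<inter> open_times n y j) \<union> ({0<..s} \<inter> ({0<..} \<inter> open_times n y j))" if "0 \<le> s" for s j
      using that by auto
    have zero: "{0} \<inter> open_times n y j \<in> sets borel" for j
      by (cases "0 \<in> open_times n y j") auto
    have closed_meas: "{0..s} \<inter> open_times n y j \<in> sets borel" if "j \<in> sources n" "0 \<le> s" for s j
      unfolding split[OF that(2)] using open_times[OF that(1)] zero by auto
    have drop0: "measure (\<tau> j) ({0..s} \<inter> open_times n y j) = measure (\<tau> j) ({0<..s} \<inter> open_times n y j)"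
      if j: "j \<in> sources n" and s: "0 \<le> s" for j s
    proof -
      have "{0} \<in> null_sets (\<tau> j)"
        using \<tau>[OF j, of "{0}"] elim(3) j by (auto simp: null_sets_def sets_\<tau>)
      then have "{0} \<inter> open_times n y j \<in> null_sets (\<tau> j)"
        using zero[of j] sets_\<tau>[OF j] by (auto intro: null_sets_subset)
      moreover have "{0<..s} \<inter> ({0<..} \<inter> open_times n y j) \<in> sets (\<tau> j)"
        using open_times[OF j] sets_\<tau>[OF j] by auto
      moreover have "{0<..s} \<inter> ({0<..} \<inter> open_times n y j) = {0<..s} \<inter> open_times n y j"
        by auto
      ultimately show ?thesis
        unfolding split[OF s] by (subst Un_commute, subst measure_Un_null_set) simp_all
    qed
    have y: "y i s = queue_length g i
        + measure (\<tau> (Inl i)) ({0<..s} \<inter> open_times n y (Inl i))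
        - measure (\<tau> (Inr i)) ({0<..s} \<inter> open_times n y (Inr i))"
      if i: "i \<in> {1..n}" and s: "0 \<le> s" for i s
    proof -
      have j: "Inl i \<in> sources n" "Inr i \<in> sources n" using i by auto
      have "(\<integral>(s', r). indicator {0..s} s' * indicator {0..c (Inl i)} r *
          of_bool (i = n \<or> left_limit (y i) s' < left_limit (y (i + 1)) s') \<partial>case_sum A D (Inl i) \<omega>) =
          measure (\<tau> (Inl i)) ({0..s} \<inter> open_times n y (Inl i))"
        using integral_marked_points[OF sets_N[OF j(1)] closed_meas[OF j(1) s, unfolded open_times_def sum.case], of "c (Inl i)"]
        by (simp add: \<tau>_def open_times_def)
      moreover have "(\<integral>(s', r). indicator {0..s} s' * indicator {0..c (Inr i)} r *
          of_bool (left_limit (y (i - 1)) s' < left_limit (y i) s') \<partial>case_sum A D (Inr i) \<omega>) =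
          measure (\<tau> (Inr i)) ({0..s} \<inter> open_times n y (Inr i))"
        using integral_marked_points[OF sets_N[OF j(2)] closed_meas[OF j(2) s, unfolded open_times_def sum.case], of "c (Inr i)"]
        by (simp add: \<tau>_def open_times_def)
      moreover have "x i = queue_length g i"
        using i n by (simp add: x_def queues_of_scaled_gaps)
      ultimately show ?thesis
        using elim(2) i s drop0[OF j(1) s] drop0[OF j(2) s]
        by (simp add: y_def[abs_def] c_def source_rate_def)
    qed
    show ?case
    proof
      assume \<omega>: "\<omega> \<in> word_event W"
      have "y i (real (length W) * h) = queue_length (fold (slot_move n) W g) i" if "i \<le> n" for i
      proof (rule path_follows_word[where \<tau> = \<tau>, OF h _ sets_\<tau> open_times y0 y _ _ _ g that])
        show "set W \<subseteq> slot_symbols n"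
          using W by (simp add: words_def)
        show "emeasure (\<tau> j) {0<..real (length W) * h} < \<infinity>" if "j \<in> sources n" for j
          using elim(4) that W by (subst \<tau>[OF that]) (auto simp: words_def)
        show "emeasure (\<tau> j) {real k * h<..real (Suc k) * h} = of_bool (W ! k = Some j)"
          if "j \<in> sources n" "k < length W" for j k
        proof -
          have "{real k * h<..real (Suc k) * h} \<subseteq> {0..}"
            using slot_times[of k] by (auto intro: order_trans less_imp_le)
          then show ?thesis
            using \<omega> that W
            by (subst \<tau>[OF that(1)]) (auto simp: words_def word_event_def slot_box_def c_def)
        qed
        show "\<exists>l::nat. emeasure (\<tau> j) {real k * h<..r} = of_nat l"
          if "j \<in> sources n" "k < length W" "r \<in> \<rat>" "real k * h < r" for j k r
        proof -
          have "{real k * h<..r} \<subseteq> {0..}"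
            using slot_times[of k] by (auto intro: order_trans less_imp_le)
          then show ?thesis
            using elim(5) that W by (subst \<tau>[OF that(1)]) (auto simp: words_def)
        qed
      qed
      then show "scaled_gaps n (\<lambda>i. Y x i (real m * h) \<omega>) = scale_gaps n (fold (slot_move n) W g)"
        using W by (intro scaled_gaps_queue_length) (auto simp: y_def words_def)
    qed
  qed
qed

text \<open>The events of the words that lead from \<open>g\<close> into \<open>S\<close> are disjoint and almost surely
contained in the event that the gaps are in \<open>S\<close> at the final time.\<close>

lemma gap_transition_ge_words:
  assumes g: "g \<in> gap_states n" and S: "S \<subseteq> gap_states n"
  shows "(\<Sum>W\<in>words n m. ennreal (word_weight a b n h W) * indicator S (fold (slot_move n) W g))
    \<le> gap_transition n M Y (real m * h) (scale_gaps n g) (scale_gaps n ` S)"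
proof -
  define x where "x = queues_of_gaps n (scale_gaps n g)"
  define V where "V = {W \<in> words n m. fold (slot_move n) W g \<in> S}"
  have "(\<Sum>W\<in>words n m. ennreal (word_weight a b n h W) * indicator S (fold (slot_move n) W g)) =
      (\<Sum>W\<in>V. ennreal (word_weight a b n h W))"
    unfolding V_def by (intro sum.mono_neutral_cong_right) auto
  also have "\<dots> = (\<Sum>W\<in>V. emeasure M (word_event W))"
    by (intro sum.cong) (auto simp: V_def emeasure_eq_measure prob_word_event)
  also have "\<dots> = emeasure M (\<Union>W\<in>V. word_event W)"
    using disjoint_word_events word_event_sets
    by (intro sum_emeasure) (auto simp: V_def intro: disjoint_family_on_mono)
  also have "\<dots> \<le> emeasure M {\<omega> \<in> space M. scaled_gaps n (\<lambda>i. Y x i (real m * h) \<omega>) \<in> scale_gaps n ` S}"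
  proof (rule emeasure_mono_AE)
    have "AE \<omega> in M. \<forall>W\<in>V. \<omega> \<in> word_event W \<longrightarrow>
        scaled_gaps n (\<lambda>i. Y x i (real m * h) \<omega>) = scale_gaps n (fold (slot_move n) W g)"
      unfolding x_def using scaled_gaps_on_word_event[OF _ g]
      by (intro AE_ball_countable[THEN iffD2]) (auto simp: V_def intro: countable_finite)
    then show "AE \<omega> in M. \<omega> \<in> (\<Union>W\<in>V. word_event W) \<longrightarrow>
        \<omega> \<in> {\<omega> \<in> space M. scaled_gaps n (\<lambda>i. Y x i (real m * h) \<omega>) \<in> scale_gaps n ` S}"
      using AE_space by eventually_elim (auto simp: V_def)
    have "ranked_queues a b n M A D x (Y x)"
      using sys ordered_initial_queues[OF n] by (simp add: system_with_pauses_def x_def)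
    then show "{\<omega> \<in> space M. scaled_gaps n (\<lambda>i. Y x i (real m * h) \<omega>) \<in> scale_gaps n ` S} \<in> events"
      using h by (intro scaled_gaps_event_sets)
        (auto simp: ranked_queues_def scale_gaps_in_gap_space)
  qed
  finally show ?thesis
    by (simp add: gap_transition_def x_def)
qed

end

section \<open>Detailed balance for product geometric weights\<close>

definition geometric_weight :: "nat \<Rightarrow> (nat \<Rightarrow> real) \<Rightarrow> (nat \<Rightarrow> nat) \<Rightarrow> real" where
  "geometric_weight n r g = (\<Prod>i=1..n. (1 - r i) * r i ^ g i)"

definition geometric_product :: "nat \<Rightarrow> (nat \<Rightarrow> real) \<Rightarrow> (nat \<Rightarrow> nat) measure" where
  "geometric_product n r = density (count_space (gap_states n)) (\<lambda>g. ennreal (geometric_weight n r g))"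

lemma space_geometric_product [simp]: "space (geometric_product n r) = gap_states n"
  and sets_geometric_product [simp]: "sets (geometric_product n r) = Pow (gap_states n)"
  by (auto simp: geometric_product_def)

lemma nn_integral_geometric_product:
  "(\<integral>\<^sup>+g. f g \<partial>geometric_product n r) =
   (\<integral>\<^sup>+g. ennreal (geometric_weight n r g) * f g \<partial>count_space (gap_states n))"
  unfolding geometric_product_def by (rule nn_integral_density) auto

lemma geometric_weight_add_unit:
  assumes "i \<in> {1..Suc n}" "r (Suc n) = 1" "g \<in> gap_states n"
  shows "geometric_weight n r (add_unit n i g) = r i * geometric_weight n r g"
proof (cases "i = Suc n")
  case False
  then have i: "i \<in> {1..n}" using assms by auto
  have "geometric_weight n r h = ((1 - r i) * r i ^ h i) * (\<Prod>k\<in>{1..n} - {i}. (1 - r k) * r k ^ h k)" for h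
    unfolding geometric_weight_def using i by (subst prod.remove[of _ i]) auto
  moreover have "(\<Prod>k\<in>{1..n} - {i}. (1 - r k) * r k ^ add_unit n i g k) =
      (\<Prod>k\<in>{1..n} - {i}. (1 - r k) * r k ^ g k)"
    by (intro prod.cong) (auto simp: add_unit_def)
  moreover have "add_unit n i g i = Suc (g i)"
    using i by (simp add: add_unit_def)
  ultimately show ?thesis
    by simp
qed (use assms in simp)

text \<open>The arrivals and departures of one queue form a reversible pair. The map from
\<open>add_unit n (i + 1) g\<close> to \<open>add_unit n i g\<close> is a bijection from the states with a particle in box
\<open>i + 1\<close> onto those with a particle in box \<open>i\<close>, and the hypothesis on \<open>\<nu>\<close>, \<open>\<mu>\<close> says that the
flow along it equals the flow back. Splitting each integral into the part where the move is possible and the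
part where it is blocked, the two flows exchange their places.\<close>

lemma detailed_balance_integrals:
  fixes f :: "(nat \<Rightarrow> nat) \<Rightarrow> ennreal" and r :: "nat \<Rightarrow> real"
  assumes i: "i \<in> {1..n}" and r: "\<And>k. k \<in> {1..Suc n} \<Longrightarrow> 0 \<le> r k" "r (Suc n) = 1"
    and rates: "0 \<le> \<nu>" "0 \<le> \<mu>" "\<nu> * r (Suc i) = \<mu> * r i"
  shows "ennreal \<nu> * (\<integral>\<^sup>+g. f (move n (Inl i) g) \<partial>geometric_product n r) +
      ennreal \<mu> * (\<integral>\<^sup>+g. f (move n (Inr i) g) \<partial>geometric_product n r) =
    ennreal (\<nu> + \<mu>) * (\<integral>\<^sup>+g. f g \<partial>geometric_product n r)"
proof -
  define w where "w g = ennreal (geometric_weight n r g)" for g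
  define S where "S = gap_states n"
  define J where "J X F = (\<integral>\<^sup>+g. w g * F g \<partial>count_space X)" for X and F :: "(nat \<Rightarrow> nat) \<Rightarrow> ennreal"
  define D where "D k = add_unit n k ` S" for k
  define K where "K k = J S (\<lambda>g. f (add_unit n k g))" for k
  have D: "D k \<subseteq> S" for k
    by (auto simp: D_def S_def)
  have J_UNIV: "J X F = (\<integral>\<^sup>+g\<in>X. w g * F g \<partial>count_space UNIV)" for X F
    unfolding J_def by (rule nn_integral_count_space_indicator) (simp add: NO_MATCH_def)
  have split: "J S F = J (D k) F + J (S - D k) F" for F k
  proof -
    have "J (D k \<union> (S - D k)) F = J (D k) F + J (S - D k) F"
      unfolding J_UNIV
      by (rule nn_integral_disjoint_pair_countspace) blast
    moreover have "D k \<union> (S - D k) = S"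
      using D[of k] by blast
    ultimately show ?thesis
      by (simp only:)
  qed
  have on_D: "J (D k) F = ennreal (r k) * J S (\<lambda>g. F (add_unit n k g))" if "k \<in> {1..Suc n}" for k F
  proof -
    have "J (D k) F = (\<integral>\<^sup>+g. w (add_unit n k g) * F (add_unit n k g) \<partial>count_space S)"
      unfolding J_def D_def S_def
      by (rule nn_integral_bij_count_space[symmetric]) (simp add: bij_betw_def inj_add_unit)
    also have "\<dots> = (\<integral>\<^sup>+g. ennreal (r k) * (w g * F (add_unit n k g)) \<partial>count_space S)"
      by (intro nn_integral_cong)
        (use that r in \<open>auto simp: w_def S_def geometric_weight_add_unit ennreal_mult' mult.assoc\<close>)
    finally show ?thesis
      by (simp add: J_def nn_integral_cmult)
  qed
  have arrivals: "J S (\<lambda>g. f (move n (Inl i) g)) = ennreal (r (Suc i)) * K i + J (S - D (Suc i)) f"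
  proof -
    have "J S (\<lambda>g. f (move n (Inl i) (add_unit n (Suc i) g))) = K i"
      unfolding K_def J_def
      by (intro nn_integral_cong) (use i in \<open>simp add: move_add_unit S_def del: move.simps\<close>)
    moreover have "J (S - D (Suc i)) (\<lambda>g. f (move n (Inl i) g)) = J (S - D (Suc i)) f"
      unfolding J_def
      by (intro nn_integral_cong) (use i in \<open>auto simp: D_def S_def range_add_unit\<close>)
    ultimately show ?thesis
      using on_D[of "Suc i" "\<lambda>g. f (move n (Inl i) g)"] i
      by (subst split[of _ "Suc i"]) (simp del: move.simps)
  qed
  have departures: "J S (\<lambda>g. f (move n (Inr i) g)) = ennreal (r i) * K (Suc i) + J (S - D i) f"
  proof -
    have "J S (\<lambda>g. f (move n (Inr i) (add_unit n i g))) = K (Suc i)"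
      unfolding K_def J_def
      by (intro nn_integral_cong) (use i in \<open>simp add: move_add_unit S_def del: move.simps\<close>)
    moreover have "J (S - D i) (\<lambda>g. f (move n (Inr i) g)) = J (S - D i) f"
      unfolding J_def
      by (intro nn_integral_cong) (use i in \<open>auto simp: D_def S_def range_add_unit\<close>)
    ultimately show ?thesis
      using on_D[of i "\<lambda>g. f (move n (Inr i) g)"] i
      by (subst split[of _ i]) (simp del: move.simps)
  qed
  have balance: "ennreal \<nu> * ennreal (r (Suc i)) = ennreal \<mu> * ennreal (r i)"
    using rates r(1)[of i] r(1)[of "Suc i"] i by (simp add: ennreal_mult[symmetric])
  have "ennreal \<nu> * J S (\<lambda>g. f (move n (Inl i) g)) + ennreal \<mu> * J S (\<lambda>g. f (move n (Inr i) g)) =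
      (ennreal \<mu> * ennreal (r i)) * K i + ennreal \<nu> * J (S - D (Suc i)) f +
      ((ennreal \<nu> * ennreal (r (Suc i))) * K (Suc i) + ennreal \<mu> * J (S - D i) f)"
    unfolding arrivals departures distrib_left balance[symmetric] mult.assoc[symmetric] ..
  also have "\<dots> = ennreal \<nu> * (ennreal (r (Suc i)) * K (Suc i) + J (S - D (Suc i)) f) +
      ennreal \<mu> * (ennreal (r i) * K i + J (S - D i) f)"
    by (simp add: distrib_left ac_simps)
  also have "ennreal (r (Suc i)) * K (Suc i) + J (S - D (Suc i)) f = J S f"
    using on_D[of "Suc i" f] i split[of f "Suc i"] by (simp add: K_def)
  also have "ennreal (r i) * K i + J (S - D i) f = J S f"
    using on_D[of i f] i split[of f i] by (simp add: K_def)
  also have "ennreal \<nu> * J S f + ennreal \<mu> * J S f = ennreal (\<nu> + \<mu>) * J S f"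
    using rates by (simp add: distrib_right)
  finally show ?thesis
    by (simp add: J_def S_def w_def nn_integral_geometric_product del: move.simps)
qed

text \<open>The lower bound of \<open>gap_transition_ge_words\<close> for a general integrand \<open>f\<close> in place of an indicator.\<close>

definition word_kernel ::
  "real \<Rightarrow> real \<Rightarrow> nat \<Rightarrow> real \<Rightarrow> nat \<Rightarrow> ((nat \<Rightarrow> nat) \<Rightarrow> ennreal) \<Rightarrow> (nat \<Rightarrow> nat) \<Rightarrow> ennreal" where
  "word_kernel a b n h m f g =
     (\<Sum>W\<in>words n m. ennreal (word_weight a b n h W) * f (fold (slot_move n) W g))"

lemma words_0 [simp]: "words n 0 = {[]}"
  by (auto simp: words_def)

lemma words_Suc: "words n (Suc m) = (\<lambda>(q, W). q # W) ` (slot_symbols n \<times> words n m)"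
  by (auto simp: words_def length_Suc_conv image_iff)

context
  fixes a b :: real and n :: nat
  assumes rate: "\<And>j. j \<in> sources n \<Longrightarrow> 0 \<le> source_rate a b n j"
begin

lemma slot_weight_nonneg: "0 \<le> h \<Longrightarrow> q \<in> slot_symbols n \<Longrightarrow> 0 \<le> slot_weight a b n h q"
  using rate by (auto simp: slot_weight_def slot_symbols_def)

lemma word_weight_nonneg: "0 \<le> h \<Longrightarrow> set W \<subseteq> slot_symbols n \<Longrightarrow> 0 \<le> word_weight a b n h W"
  by (induction W) (auto simp: word_weight_def slot_weight_nonneg)

lemma total_rate_nonneg: "0 \<le> total_rate a b n"
  unfolding total_rate_def using rate by (rule sum_nonneg)

lemma word_kernel_Suc:
  assumes "0 \<le> h"
  shows "word_kernel a b n h (Suc m) f g =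
    (\<Sum>q\<in>slot_symbols n. ennreal (slot_weight a b n h q) * word_kernel a b n h m f (slot_move n q g))"
proof -
  have inj: "inj_on (\<lambda>(q, W). q # W) (slot_symbols n \<times> words n m)"
    by (auto simp: inj_on_def)
  have "word_kernel a b n h (Suc m) f g =
      (\<Sum>(q, W)\<in>slot_symbols n \<times> words n m.
        ennreal (word_weight a b n h (q # W)) * f (fold (slot_move n) (q # W) g))"
    unfolding word_kernel_def words_Suc by (subst sum.reindex[OF inj]) (simp add: case_prod_unfold o_def)
  also have "\<dots> = (\<Sum>q\<in>slot_symbols n. \<Sum>W\<in>words n m.
        ennreal (slot_weight a b n h q) * (ennreal (word_weight a b n h W) * f (fold (slot_move n) W (slot_move n q g))))"
    unfolding sum.cartesian_product[symmetric]
    using assms by (intro sum.cong)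
      (auto simp: word_weight_def[of _ _ _ _ "_ # _"] word_weight_def[symmetric] words_def
        ennreal_mult slot_weight_nonneg word_weight_nonneg mult.assoc)
  finally show ?thesis
    by (simp add: word_kernel_def sum_distrib_left)
qed

text \<open>Summing detailed balance over the queues, the operators \<open>T\<^sub>j\<close> that apply the moves satisfy
\<open>\<pi> (\<Sum>\<^sub>j \<lambda>\<^sub>j T\<^sub>j) = \<Lambda> \<pi>\<close>.\<close>

lemma slot_invariance:
  fixes f :: "(nat \<Rightarrow> nat) \<Rightarrow> ennreal" and r :: "nat \<Rightarrow> real"
  assumes r: "\<And>k. k \<in> {1..Suc n} \<Longrightarrow> 0 \<le> r k" "r (Suc n) = 1"
    and balance: "\<And>i. i \<in> {1..n} \<Longrightarrow> arrival_rate a b n i * r (Suc i) = real n * r i"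
    and h: "0 \<le> h"
  shows "(\<Sum>q\<in>slot_symbols n. ennreal (slot_weight a b n h q) *
      (\<integral>\<^sup>+g. f (slot_move n q g) \<partial>geometric_product n r)) =
    ennreal (exp (- (h * total_rate a b n)) * (1 + h * total_rate a b n)) *
      (\<integral>\<^sup>+g. f g \<partial>geometric_product n r)"
proof -
  define I where "I F = (\<integral>\<^sup>+g. F g \<partial>geometric_product n r)" for F :: "(nat \<Rightarrow> nat) \<Rightarrow> ennreal"
  define e where "e = exp (- (h * total_rate a b n))"
  have e: "0 \<le> e" by (simp add: e_def)
  have arr: "0 \<le> arrival_rate a b n i" if "i \<in> {1..n}" for i
    using rate[of "Inl i"] that by (simp add: source_rate_def)
  have "(\<Sum>j\<in>sources n. ennreal (source_rate a b n j) * I (\<lambda>g. f (move n j g))) =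
      (\<Sum>i=1..n. ennreal (arrival_rate a b n i) * I (\<lambda>g. f (move n (Inl i) g)) +
        ennreal (real n) * I (\<lambda>g. f (move n (Inr i) g)))"
    unfolding sources_def
    by (subst sum.Plus) (auto simp: source_rate_def sum.distrib simp del: move.simps)
  also have "\<dots> = (\<Sum>i=1..n. ennreal (arrival_rate a b n i + real n) * I f)"
    unfolding I_def by (intro sum.cong detailed_balance_integrals) (use r balance arr in auto)
  also have "\<dots> = ennreal (\<Sum>i=1..n. arrival_rate a b n i + real n) * I f"
    unfolding sum_distrib_right[symmetric] using arr by (subst sum_ennreal) auto
  also have "(\<Sum>i=1..n. arrival_rate a b n i + real n) = total_rate a b n"
    unfolding total_rate_def sources_def
    by (subst sum.Plus) (auto simp: source_rate_def sum.distrib)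
  finally have moves: "(\<Sum>j\<in>sources n. ennreal (source_rate a b n j) * I (\<lambda>g. f (move n j g))) =
      ennreal (total_rate a b n) * I f" .
  \<comment> \<open>The idle letter contributes one more copy of the integral, which accounts for the summand 1.\<close>
  have "(\<Sum>q\<in>slot_symbols n. ennreal (slot_weight a b n h q) * I (\<lambda>g. f (slot_move n q g))) =
      ennreal (slot_weight a b n h None) * I (\<lambda>g. f (slot_move n None g)) +
      (\<Sum>j\<in>sources n. ennreal (slot_weight a b n h (Some j)) * I (\<lambda>g. f (slot_move n (Some j) g)))"
    unfolding slot_symbols_def by (subst sum.insert) (auto simp: sum.reindex)
  also have "\<dots> = ennreal e * I f +
      (\<Sum>j\<in>sources n. ennreal e * (ennreal h * (ennreal (source_rate a b n j) * I (\<lambda>g. f (move n j g)))))"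
    using h e rate by (intro arg_cong2[of _ _ _ _ "(+)"] sum.cong)
      (auto simp: slot_weight_def slot_move_def e_def[symmetric] ennreal_mult mult.assoc)
  also have "\<dots> = ennreal e * I f + ennreal e * (ennreal h * (ennreal (total_rate a b n) * I f))"
    by (simp add: sum_distrib_left[symmetric] moves)
  also have "\<dots> = ennreal (e * (1 + h * total_rate a b n)) * I f"
    using h e total_rate_nonneg by (simp add: ennreal_mult ennreal_plus distrib_left distrib_right mult.assoc)
  finally show ?thesis
    by (simp add: I_def e_def)
qed

lemma word_kernel_invariance:
  fixes f :: "(nat \<Rightarrow> nat) \<Rightarrow> ennreal" and r :: "nat \<Rightarrow> real"
  assumes r: "\<And>k. k \<in> {1..Suc n} \<Longrightarrow> 0 \<le> r k" "r (Suc n) = 1"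
    and balance: "\<And>i. i \<in> {1..n} \<Longrightarrow> arrival_rate a b n i * r (Suc i) = real n * r i"
    and h: "0 \<le> h"
  shows "(\<integral>\<^sup>+g. word_kernel a b n h m f g \<partial>geometric_product n r) =
    ennreal ((exp (- (h * total_rate a b n)) * (1 + h * total_rate a b n)) ^ m) *
      (\<integral>\<^sup>+g. f g \<partial>geometric_product n r)"
proof (induction m)
  case 0
  then show ?case by (simp add: word_kernel_def word_weight_def)
next
  case (Suc m)
  define k where "k = exp (- (h * total_rate a b n)) * (1 + h * total_rate a b n)"
  have k: "0 \<le> k"
    using h total_rate_nonneg by (simp add: k_def)
  have meas: "F \<in> borel_measurable (geometric_product n r)" for F :: "(nat \<Rightarrow> nat) \<Rightarrow> ennreal"
    by (simp add: geometric_product_def)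
  have "(\<integral>\<^sup>+g. word_kernel a b n h (Suc m) f g \<partial>geometric_product n r) =
      (\<Sum>q\<in>slot_symbols n. ennreal (slot_weight a b n h q) *
        (\<integral>\<^sup>+g. word_kernel a b n h m f (slot_move n q g) \<partial>geometric_product n r))"
    unfolding word_kernel_Suc[OF h]
    by (subst nn_integral_sum) (auto simp: meas nn_integral_cmult)
  also have "\<dots> = ennreal k * (\<integral>\<^sup>+g. word_kernel a b n h m f g \<partial>geometric_product n r)"
    unfolding k_def by (rule slot_invariance[OF r balance h])
  finally show ?case
    using k unfolding Suc k_def[symmetric] by (simp add: ennreal_mult mult.assoc)
qed

end

section \<open>Irreducibility\<close>

lemma inj_scale_gaps: "0 < n \<Longrightarrow> inj_on (scale_gaps n) (gap_states n)"
proof (rule inj_onI)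
  fix g g' assume *: "0 < n" "g \<in> gap_states n" "g' \<in> gap_states n" "scale_gaps n g = scale_gaps n g'"
  show "g = g'"
  proof (rule gap_states_eqI[OF *(2,3)])
    fix i assume "i \<in> {1..n}"
    then show "g i = g' i"
      using fun_cong[OF *(4), of i] *(1) by (simp add: scale_gaps_def)
  qed
qed

lemma gap_space_eq: "gap_space n = scale_gaps n ` gap_states n"
proof (intro equalityI subsetI)
  fix u assume u: "u \<in> gap_space n"
  then have "\<forall>i\<in>{1..n}. \<exists>m::nat. u i = real m / sqrt (real n)"
    by (auto simp: gap_space_def PiE_def Pi_def)
  then obtain g where g: "\<And>i. i \<in> {1..n} \<Longrightarrow> u i = real (g i) / sqrt (real n)"
    by metis
  have "u i = scale_gaps n (restrict g {1..n}) i" for i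
    using g[of i] u by (auto simp: scale_gaps_def gap_space_def PiE_def extensional_def)
  then have "u = scale_gaps n (restrict g {1..n})" ..
  moreover have "restrict g {1..n} \<in> gap_states n"
    by simp
  ultimately show "u \<in> scale_gaps n ` gap_states n"
    by (rule image_eqI)
qed (auto simp: scale_gaps_in_gap_space)

lemma countable_gap_states: "countable (gap_states n)"
  unfolding gap_states_def by (rule countable_PiE) auto

definition reachable :: "nat \<Rightarrow> (nat \<Rightarrow> nat) \<Rightarrow> (nat \<Rightarrow> nat) \<Rightarrow> bool" where
  "reachable n g g' \<longleftrightarrow> (\<exists>W. set W \<subseteq> slot_symbols n \<and> fold (slot_move n) W g = g')"

lemma reachable_refl: "reachable n g g"
  unfolding reachable_def by (rule exI[of _ "[]"]) simp

lemma reachable_trans: "reachable n g g' \<Longrightarrow> reachable n g' g'' \<Longrightarrow> reachable n g g''"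
  unfolding reachable_def by (metis fold_append comp_apply set_append Un_least)

lemma reachable_move: "j \<in> sources n \<Longrightarrow> reachable n g (move n j g)"
  unfolding reachable_def
  by (rule exI[of _ "[Some j]"]) (simp add: slot_move_def slot_symbols_def)

text \<open>A particle is brought into box \<open>i\<close> from the reservoir by successive arrivals at the queues
\<open>n, n - 1, \<dots>, i\<close>, and is removed by the departures in the opposite order.\<close>

lemma reachable_add_unit:
  assumes g: "g \<in> gap_states n" and i: "1 \<le> i" "i \<le> Suc n"
  shows "reachable n g (add_unit n i g) \<and> reachable n (add_unit n i g) g"
  using i(2,1)
proof (induction i rule: inc_induct)
  case base
  then show ?case using g by (simp add: reachable_refl)
next
  case (step k)
  then have k: "k \<in> {1..n}" by simp
  have "reachable n (add_unit n (Suc k) g) (add_unit n k g)"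
    "reachable n (add_unit n k g) (add_unit n (Suc k) g)"
    using reachable_move[of "Inl k" n "add_unit n (Suc k) g"] reachable_move[of "Inr k" n "add_unit n k g"] k
    unfolding move_add_unit[OF g k] by auto
  then show ?case
    using step k reachable_trans by (metis le_SucI)
qed

lemma reachable_from_empty:
  assumes "g \<in> gap_states n"
  shows "reachable n g (\<lambda>i\<in>{1..n}. 0) \<and> reachable n (\<lambda>i\<in>{1..n}. 0) g"
  using assms
proof (induction "\<Sum>i=1..n. g i" arbitrary: g)
  case 0
  then have "g = (\<lambda>i\<in>{1..n}. 0)"
    by (intro gap_states_eqI[of _ n]) auto
  then show ?case by (simp add: reachable_refl)
next
  case (Suc k)
  have "(\<Sum>i=1..n. g i) \<noteq> 0"
    using Suc.hyps(2) by linarith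
  then obtain i where "i \<in> {1..n}" "g i \<noteq> 0"
    by (rule sum.not_neutral_contains_not_neutral)
  then have i: "i \<in> {1..n}" "0 < g i"
    by auto
  then have "g \<in> add_unit n i ` gap_states n"
    using Suc.prems by (subst range_add_unit) auto
  then obtain g0 where g0: "g0 \<in> gap_states n" "g = add_unit n i g0"
    by auto
  have "(\<Sum>l=1..n. g l) = (\<Sum>l=1..n. g0 l + (if l = i then 1 else 0))"
    unfolding g0(2) by (intro sum.cong) (auto simp: add_unit_def)
  also have "\<dots> = Suc (\<Sum>l=1..n. g0 l)"
    using i(1) by (simp add: sum.distrib)
  finally have "k = (\<Sum>l=1..n. g0 l)"
    using Suc.hyps(2) by simp
  from Suc.hyps(1)[OF this g0(1)] reachable_add_unit[OF g0(1), of i] i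
  show ?case
    unfolding g0(2) using reachable_trans by (metis atLeastAtMost_iff le_SucI)
qed

lemma all_reachable:
  "g \<in> gap_states n \<Longrightarrow> g' \<in> gap_states n \<Longrightarrow> reachable n g g'"
  using reachable_from_empty reachable_trans by metis

section \<open>Uniqueness of the stationary distribution\<close>

lemma emeasure_density_count_space_singleton:
  fixes f :: "'a \<Rightarrow> ennreal"
  assumes x: "x \<in> A"
  shows "emeasure (density (count_space A) f) {x} = f x"
proof -
  have "emeasure (density (count_space A) f) {x} = (\<integral>\<^sup>+y. f x * indicator {x} y \<partial>count_space A)"
    using x by (subst emeasure_density) (auto intro!: nn_integral_cong simp: indicator_def)
  then show ?thesis
    using x by (simp add: nn_integral_cmult_indicator)
qed

text \<open>Let \<open>B\<close> be the set of states to which \<open>\<pi>\<close> gives more mass than \<open>\<pi>'\<close>. Stationarity says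
that \<open>1\<^sub>B - P\<^sub>t(\<cdot>, B)\<close> has integral zero under both measures, hence under \<open>\<pi> - \<pi>'\<close>. But this
function is nonnegative on \<open>B\<close> and nonpositive elsewhere, so it has the sign of the density of
\<open>\<pi> - \<pi>'\<close>, and the integral can vanish only if the product is zero in every state. By positivity of
\<open>P\<^sub>t\<close> the function is strictly positive on \<open>B\<close> unless \<open>B\<close> is the whole space, which equal total
masses exclude; so \<open>B\<close> is empty.\<close>

lemma stationary_distribution_unique:
  fixes P :: "real \<Rightarrow> 'a \<Rightarrow> 'a set \<Rightarrow> ennreal"
  assumes S: "countable S" and t: "0 \<le> t"
    and \<pi>: "stationary_distribution S P \<pi>" and \<pi>': "stationary_distribution S P \<pi>'"
    and split: "\<And>u B. u \<in> S \<Longrightarrow> B \<subseteq> S \<Longrightarrow> P t u B + P t u (S - B) \<le> 1"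
    and positive: "\<And>u B. u \<in> S \<Longrightarrow> B \<subseteq> S \<Longrightarrow> B \<noteq> {} \<Longrightarrow> 0 < P t u B"
  shows "\<pi>' = \<pi>"
proof -
  define mass where "mass \<mu> u = measure \<mu> {u}" for \<mu> :: "'a measure" and u
  have point_masses: "integrable (count_space S) (\<lambda>u. mass \<mu> u * g u) \<and>
      (\<integral>u. mass \<mu> u * g u \<partial>count_space S) = (\<integral>u. g u \<partial>\<mu>)"
    if \<mu>: "stationary_distribution S P \<mu>" and g: "\<And>u. u \<in> S \<Longrightarrow> \<bar>g u\<bar> \<le> 1" for \<mu> and g :: "'a \<Rightarrow> real"
  proof -
    interpret \<mu>: prob_space \<mu>
      using \<mu> by (simp add: stationary_distribution_def)
    have sets: "sets \<mu> = Pow S" and space: "space \<mu> = S"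
      using \<mu> sets_eq_imp_space_eq[of \<mu> "count_space S"] by (auto simp: stationary_distribution_def)
    have \<mu>_eq: "\<mu> = density (count_space S) (\<lambda>u. ennreal (mass \<mu> u))"
    proof (rule measure_eqI_countable[OF sets _ S])
      fix u assume u: "u \<in> S"
      show "emeasure \<mu> {u} = emeasure (density (count_space S) (\<lambda>u. ennreal (mass \<mu> u))) {u}"
        unfolding emeasure_density_count_space_singleton[OF u]
        by (simp add: mass_def \<mu>.emeasure_eq_measure)
    qed simp
    have "integrable \<mu> g"
      by (rule \<mu>.integrable_const_bound[of _ 1])
        (use g in \<open>auto simp: space measurable_def sets\<close>)
    then have "integrable (count_space S) (\<lambda>u. mass \<mu> u * g u)"
      by (subst (asm) \<mu>_eq, subst (asm) integrable_real_density) (auto simp: mass_def)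
    moreover have "(\<integral>u. mass \<mu> u * g u \<partial>count_space S) = (\<integral>u. g u \<partial>\<mu>)"
      by (subst (2) \<mu>_eq, subst integral_real_density) (auto simp: mass_def)
    ultimately show ?thesis by blast
  qed
  \<comment> \<open>A function with the sign of the difference of the densities and with equal integrals vanishes where they differ.\<close>
  have agree: "mass \<pi> u * g u = mass \<pi>' u * g u"
    if g: "\<And>u. u \<in> S \<Longrightarrow> \<bar>g u\<bar> \<le> 1" and eq: "(\<integral>u. g u \<partial>\<pi>) = (\<integral>u. g u \<partial>\<pi>')"
      and sign: "\<And>u. u \<in> S \<Longrightarrow> mass \<pi>' u * g u \<le> mass \<pi> u * g u" and u: "u \<in> S" for g u
  proof -
    note p = point_masses[OF \<pi> g] and q = point_masses[OF \<pi>' g]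
    have "(\<integral>u. mass \<pi> u * g u - mass \<pi>' u * g u \<partial>count_space S) = 0"
      using p q eq by (simp add: Bochner_Integration.integral_diff)
    moreover have "integrable (count_space S) (\<lambda>u. mass \<pi> u * g u - mass \<pi>' u * g u)"
      using p q by (intro Bochner_Integration.integrable_diff) auto
    ultimately have "AE u in count_space S. mass \<pi> u * g u - mass \<pi>' u * g u = 0"
      using sign by (subst (asm) integral_nonneg_eq_0_iff_AE) (auto simp: AE_count_space)
    then show ?thesis
      using u by (auto simp: AE_count_space)
  qed
  have prob: "prob_space \<pi>" "prob_space \<pi>'"
    and sets: "sets \<pi> = Pow S" "sets \<pi>' = Pow S"
    using \<pi> \<pi>' by (auto simp: stationary_distribution_def)
  have space: "space \<pi> = S" "space \<pi>' = S"
    using sets_eq_imp_space_eq[of \<pi> "count_space S"] sets_eq_imp_space_eq[of \<pi>' "count_space S"] sets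
    by auto
  have total: "(\<integral>u. c \<partial>\<pi>) = (\<integral>u. c \<partial>\<pi>')" for c :: real
    using prob by (simp add: prob_space.prob_space)
  define B where "B = {u \<in> S. mass \<pi>' u < mass \<pi> u}"
  have "B = {}"
  proof (rule ccontr)
    assume "B \<noteq> {}"
    then obtain v where v: "v \<in> S" "mass \<pi>' v < mass \<pi> v"
      by (auto simp: B_def)
    show False
    proof (cases "B = S")
      case True
      then show False
        using agree[of "\<lambda>_. 1" v] total v by (force simp: B_def)
    next
      case False
      have BS: "B \<subseteq> S" by (auto simp: B_def)
      define f where "f u = enn2real (P t u B)" for u
      have P_le: "P t u B \<le> 1" if "u \<in> S" for u
      proof -
        have "P t u B \<le> P t u B + P t u (S - B)" by simp
        also have "\<dots> \<le> 1" by (rule split[OF that BS])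
        finally show ?thesis .
      qed
      have f: "ennreal (f u) = P t u B" "0 \<le> f u" "f u \<le> 1" if "u \<in> S" for u
      proof -
        have "P t u B < \<top>" using P_le[OF that] by (rule order.strict_trans1) simp
        then show e: "ennreal (f u) = P t u B" by (simp add: f_def)
        show "0 \<le> f u" by (simp add: f_def)
        have "ennreal (f u) \<le> ennreal 1" using e P_le[OF that] by simp
        then show "f u \<le> 1" by (subst (asm) ennreal_le_iff) auto
      qed
      have f_less: "f u < 1" if u: "u \<in> S" for u
      proof -
        have "0 < P t u (S - B)"
          using positive[OF u, of "S - B"] False BS by blast
        moreover have "P t u (S - B) \<le> 1"
        proof -
          have "P t u (S - B) \<le> P t u B + P t u (S - B)" by simp
          also have "\<dots> \<le> 1" by (rule split[OF u BS])
          finally show ?thesis .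
        qed
        ultimately obtain d where d: "P t u (S - B) = ennreal d" "0 < d"
          by (cases "P t u (S - B)") (auto simp: top_unique)
        have "ennreal (f u + d) \<le> ennreal 1"
          using split[OF u BS] d f[OF u] by (simp add: ennreal_plus)
        then have "f u + d \<le> 1"
          by (subst (asm) ennreal_le_iff) auto
        then show ?thesis using d by simp
      qed
      define g where "g u = indicator B u - f u" for u
      have int_g: "(\<integral>u. g u \<partial>\<mu>) = 0" if \<mu>: "stationary_distribution S P \<mu>" for \<mu>
      proof -
        interpret \<mu>: prob_space \<mu>
          using \<mu> by (simp add: stationary_distribution_def)
        have s: "sets \<mu> = Pow S" and sp: "space \<mu> = S"
          using \<mu> sets_eq_imp_space_eq[of \<mu> "count_space S"] by (auto simp: stationary_distribution_def)
        have meas: "f \<in> borel_measurable \<mu>"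
          by (auto simp: measurable_def s sp)
        have "integrable \<mu> f"
          by (rule \<mu>.integrable_const_bound[of _ 1]) (use f meas in \<open>auto simp: sp\<close>)
        moreover have "integrable \<mu> (indicator B :: 'a \<Rightarrow> real)"
          using BS by (simp add: s \<mu>.emeasure_eq_measure)
        moreover have "(\<integral>u. f u \<partial>\<mu>) = measure \<mu> B"
        proof -
          have "(\<integral>u. f u \<partial>\<mu>) = enn2real (\<integral>\<^sup>+u. ennreal (f u) \<partial>\<mu>)"
            using f meas by (intro integral_eq_nn_integral) (auto simp: sp)
          also have "(\<integral>\<^sup>+u. ennreal (f u) \<partial>\<mu>) = (\<integral>\<^sup>+u. P t u B \<partial>\<mu>)"
            using f by (intro nn_integral_cong) (auto simp: sp)
          also have "\<dots> = emeasure \<mu> B"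
            using \<mu> t BS by (simp add: stationary_distribution_def)
          finally show ?thesis by (simp add: measure_def)
        qed
        moreover have "(\<integral>u. indicator B u \<partial>\<mu>) = measure \<mu> B"
          using BS sp by (simp add: Int_absorb2)
        ultimately show ?thesis
          unfolding g_def by (subst Bochner_Integration.integral_diff) auto
      qed
      have "mass \<pi> v * g v = mass \<pi>' v * g v"
      proof (rule agree)
        show "\<bar>g u\<bar> \<le> 1" if "u \<in> S" for u
          using f[OF that] by (auto simp: g_def indicator_def)
        show "(\<integral>u. g u \<partial>\<pi>) = (\<integral>u. g u \<partial>\<pi>')"
          using int_g \<pi> \<pi>' by simp
        show "mass \<pi>' u * g u \<le> mass \<pi> u * g u" if u: "u \<in> S" for u
        proof (cases "u \<in> B")
          case True
          then show ?thesis
            using f[OF u] by (intro mult_right_mono) (auto simp: B_def g_def)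
        next
          case False
          then have "mass \<pi> u \<le> mass \<pi>' u" using u by (auto simp: B_def)
          then show ?thesis
            using f[OF u] False by (simp add: g_def mult_right_mono)
        qed
      qed (use v in auto)
      moreover have "0 < g v"
        using f_less v by (auto simp: g_def B_def)
      ultimately show False
        using v by simp
    qed
  qed
  then have le: "mass \<pi> u \<le> mass \<pi>' u" if "u \<in> S" for u
    using that by (force simp: B_def not_less[symmetric])
  have "mass \<pi> u = mass \<pi>' u" if "u \<in> S" for u
    using agree[of "\<lambda>_. -1" u] total[of "-1"] le that by simp
  then have "emeasure \<pi>' {u} = emeasure \<pi> {u}" if "u \<in> S" for u
    using that prob by (simp add: mass_def prob_space_def finite_measure.emeasure_eq_measure)
  then show ?thesis
    by (rule measure_eqI_countable[OF sets(2,1) S])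
qed

section \<open>Stationarity of the product geometric law\<close>

definition gap_law :: "nat \<Rightarrow> (nat \<Rightarrow> real) \<Rightarrow> (nat \<Rightarrow> real) measure" where
  "gap_law n r = distr (geometric_product n r) (count_space (gap_space n)) (scale_gaps n)"

lemma measurable_scale_gaps: "scale_gaps n \<in> measurable (geometric_product n r) (count_space (gap_space n))"
  by (auto simp: measurable_def scale_gaps_in_gap_space)

text \<open>The expression is the probability that no slot contains two points, for Poisson points of
total rate \<open>L\<close> and \<open>m\<close> slots.\<close>

lemma poisson_words_exhaust:
  fixes t L :: real
  assumes "0 \<le> t" "0 \<le> L"
  shows "(\<lambda>m. (exp (- (t / real m * L)) * (1 + t / real m * L)) ^ m) \<longlonglongrightarrow> 1"
proof -
  have "(\<lambda>m. exp (- (t * L)) * (1 + t * L / real m) ^ m) \<longlonglongrightarrow> exp (- (t * L)) * exp (t * L)"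
    by (intro tendsto_intros tendsto_exp_limit_sequentially)
  moreover have "\<forall>\<^sub>F m in sequentially. exp (- (t * L)) * (1 + t * L / real m) ^ m =
      (exp (- (t / real m * L)) * (1 + t / real m * L)) ^ m"
    using eventually_gt_at_top[of 0]
    by eventually_elim (simp add: power_mult_distrib exp_of_nat_mult[symmetric])
  ultimately show ?thesis
    by (simp add: exp_minus tendsto_cong)
qed

context
  fixes a b :: real and n :: nat and M :: "'w measure"
    and A D :: "nat \<Rightarrow> 'w \<Rightarrow> (real \<times> real) measure"
    and Y :: "(nat \<Rightarrow> real) \<Rightarrow> nat \<Rightarrow> real \<Rightarrow> 'w \<Rightarrow> real"
  assumes sys: "system_with_pauses a b n M A D Y" and n: "0 < n"
begin

interpretation prob_space M
  using sys by (rule prob_space_system)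

lemma gap_event_sets:
  assumes "u \<in> gap_space n" "B \<subseteq> gap_space n" "0 \<le> t"
  shows "{\<omega> \<in> space M. scaled_gaps n (\<lambda>i. Y (queues_of_gaps n u) i t \<omega>) \<in> B} \<in> events"
proof (rule scaled_gaps_event_sets[OF _ assms(2)])
  obtain g where "u = scale_gaps n g"
    using assms(1) by (auto simp: gap_space_eq)
  then have "ranked_queues a b n M A D (queues_of_gaps n u) (Y (queues_of_gaps n u))"
    using sys ordered_initial_queues[OF n] by (simp add: system_with_pauses_def)
  then show "Y (queues_of_gaps n u) i t \<in> borel_measurable M" if "i \<in> {0..n}" for i
    using that assms(3) by (simp add: ranked_queues_def)
qed

lemma gap_transition_split:
  assumes "u \<in> gap_space n" "B \<subseteq> gap_space n" "0 \<le> t"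
  shows "gap_transition n M Y t u B + gap_transition n M Y t u (gap_space n - B) \<le> 1"
proof -
  define E where "E B = {\<omega> \<in> space M. scaled_gaps n (\<lambda>i. Y (queues_of_gaps n u) i t \<omega>) \<in> B}" for B
  have "emeasure M (E B) + emeasure M (E (gap_space n - B)) = emeasure M (E B \<union> E (gap_space n - B))"
    using gap_event_sets[OF assms(1) _ assms(3)] assms(2)
    by (intro plus_emeasure) (auto simp: E_def)
  also have "\<dots> \<le> 1"
    by (rule emeasure_le_1)
  finally show ?thesis
    by (simp add: gap_transition_def E_def)
qed

text \<open>A word leading from the one state to the other has positive weight. Prefixing an idle slot
makes its length positive, so that \<open>t\<close> can be divided into that many slots.\<close>

lemma gap_transition_positive:
  assumes rate: "\<And>j. j \<in> sources n \<Longrightarrow> 0 < source_rate a b n j"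
    and u: "u \<in> gap_space n" and B: "B \<subseteq> gap_space n" "B \<noteq> {}" and t: "0 < t"
  shows "0 < gap_transition n M Y t u B"
proof -
  obtain v where v: "v \<in> B" using B by auto
  obtain g g' where g: "g \<in> gap_states n" "u = scale_gaps n g" "g' \<in> gap_states n" "v = scale_gaps n g'"
  proof -
    have "u \<in> scale_gaps n ` gap_states n" "v \<in> scale_gaps n ` gap_states n"
      using u v B(1) unfolding gap_space_eq by auto
    then show ?thesis using that by blast
  qed
  obtain V where V: "set V \<subseteq> slot_symbols n" "fold (slot_move n) V g = g'"
    using all_reachable[OF g(1,3)] by (auto simp: reachable_def)
  define W where "W = None # V"
  define m where "m = length W"
  define h where "h = t / real m"
  have m: "0 < m" and h: "0 < h" and mh: "real m * h = t"
    using t by (auto simp: m_def W_def h_def)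
  have W: "W \<in> words n m" "fold (slot_move n) W g = g'"
    using V by (auto simp: W_def words_def m_def slot_symbols_def slot_move_def)
  have "0 < slot_weight a b n h q" if "q \<in> slot_symbols n" for q
    using that h rate by (auto simp: slot_weight_def slot_symbols_def)
  then have "0 < word_weight a b n h X" if "set X \<subseteq> slot_symbols n" for X
    using that by (induction X) (auto simp: word_weight_def)
  then have "0 < ennreal (word_weight a b n h W) * indicator {g'} (fold (slot_move n) W g)"
    using W by (simp add: words_def)
  also have "\<dots> \<le> (\<Sum>W\<in>words n m. ennreal (word_weight a b n h W) * indicator {g'} (fold (slot_move n) W g))"
    using W(1) by (intro member_le_sum) auto
  also have "\<dots> \<le> gap_transition n M Y (real m * h) (scale_gaps n g) (scale_gaps n ` {g'})"
    using rate g h by (intro gap_transition_ge_words[OF sys n m]) (auto intro: less_imp_le)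
  also have "\<dots> = gap_transition n M Y t u {v}"
    using g mh by simp
  also have "\<dots> \<le> gap_transition n M Y t u B"
    unfolding gap_transition_def
    using gap_event_sets[OF u B(1), of t] t v by (intro emeasure_mono) auto
  finally show ?thesis .
qed

context
  fixes r :: "nat \<Rightarrow> real"
  assumes rate: "\<And>j. j \<in> sources n \<Longrightarrow> 0 \<le> source_rate a b n j"
    and r: "\<And>k. k \<in> {1..Suc n} \<Longrightarrow> 0 \<le> r k" "r (Suc n) = 1"
    and balance: "\<And>i. i \<in> {1..n} \<Longrightarrow> arrival_rate a b n i * r (Suc i) = real n * r i"
    and prob: "prob_space (geometric_product n r)"
begin

interpretation G: prob_space "geometric_product n r"
  by (rule prob)

text \<open>Integrating the lower bound over the reversible law gives \<open>\<kappa> m ^ m\<close> times the mass of \<open>S\<close>, for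
every number \<open>m\<close> of slots, where \<open>\<kappa> m\<close> is the probability that a slot has at most one
point; and \<open>\<kappa> m ^ m\<close> tends to \<open>1\<close>.\<close>

lemma transition_integral_ge:
  assumes S: "S \<subseteq> gap_states n" and t: "0 \<le> t"
  shows "emeasure (geometric_product n r) S \<le>
    (\<integral>\<^sup>+g. gap_transition n M Y t (scale_gaps n g) (scale_gaps n ` S) \<partial>geometric_product n r)"
    (is "_ \<le> ?I")
proof -
  define p where "p = measure (geometric_product n r) S"
  define \<kappa> where "\<kappa> m = exp (- (t / real m * total_rate a b n)) * (1 + t / real m * total_rate a b n)" for m :: nat
  have L: "0 \<le> total_rate a b n"
    using rate by (rule total_rate_nonneg)
  have le: "ennreal (\<kappa> m ^ m * p) \<le> ?I" if m: "0 < m" for m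
  proof -
    have "ennreal (\<kappa> m ^ m * p) = ennreal (\<kappa> m ^ m) * (\<integral>\<^sup>+g. indicator S g \<partial>geometric_product n r)"
      using S t L by (simp add: p_def G.emeasure_eq_measure \<kappa>_def ennreal_mult)
    also have "\<dots> = (\<integral>\<^sup>+g. word_kernel a b n (t / real m) m (indicator S) g \<partial>geometric_product n r)"
      unfolding \<kappa>_def using t by (intro word_kernel_invariance[symmetric] rate r balance) auto
    also have "\<dots> \<le> ?I"
    proof (rule nn_integral_mono)
      fix g assume "g \<in> space (geometric_product n r)"
      then show "word_kernel a b n (t / real m) m (indicator S) g \<le>
          gap_transition n M Y t (scale_gaps n g) (scale_gaps n ` S)"
        using gap_transition_ge_words[OF sys n m, of "t / real m" g S] rate S t m
        by (simp add: word_kernel_def)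
    qed
    finally show ?thesis .
  qed
  have "(\<lambda>m. \<kappa> m ^ m * p) \<longlonglongrightarrow> 1 * p"
    unfolding \<kappa>_def by (intro tendsto_mult tendsto_const poisson_words_exhaust t L)
  then have "(\<lambda>m. ennreal (\<kappa> m ^ m * p)) \<longlonglongrightarrow> ennreal p"
    by (intro tendsto_ennrealI) simp
  then have "ennreal p \<le> ?I"
    by (rule LIMSEQ_le_const2) (use le in \<open>auto intro!: exI[of _ 1]\<close>)
  then show ?thesis
    by (simp add: p_def G.emeasure_eq_measure)
qed

text \<open>Both the lower bounds for \<open>S\<close> and for its complement hold, and the left-hand sides add up to at
most one, which is the sum of the right-hand sides.\<close>

lemma transition_integral_eq:
  assumes S: "S \<subseteq> gap_states n" and t: "0 \<le> t"
  shows "(\<integral>\<^sup>+g. gap_transition n M Y t (scale_gaps n g) (scale_gaps n ` S) \<partial>geometric_product n r) =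
    emeasure (geometric_product n r) S"
proof (rule antisym)
  define I where "I S = (\<integral>\<^sup>+g. gap_transition n M Y t (scale_gaps n g) (scale_gaps n ` S) \<partial>geometric_product n r)"
    for S
  define \<mu> where "\<mu> = emeasure (geometric_product n r)"
  have meas: "F \<in> borel_measurable (geometric_product n r)" for F :: "(nat \<Rightarrow> nat) \<Rightarrow> ennreal"
    by (simp add: geometric_product_def)
  have compl: "scale_gaps n ` (gap_states n - S) = gap_space n - scale_gaps n ` S"
    unfolding gap_space_eq using inj_on_image_set_diff[OF inj_scale_gaps[OF n], of "gap_states n" S] S by auto
  have "I S + I (gap_states n - S) = (\<integral>\<^sup>+g. gap_transition n M Y t (scale_gaps n g) (scale_gaps n ` S) +
      gap_transition n M Y t (scale_gaps n g) (scale_gaps n ` (gap_states n - S)) \<partial>geometric_product n r)"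
    unfolding I_def by (rule nn_integral_add[symmetric, OF meas meas])
  also have "\<dots> \<le> (\<integral>\<^sup>+g. 1 \<partial>geometric_product n r)"
    unfolding compl using S
    by (intro nn_integral_mono gap_transition_split[OF scale_gaps_in_gap_space _ t])
      (auto simp: gap_space_eq)
  also have "\<dots> = 1"
    using G.emeasure_space_1 by simp
  also have "1 = \<mu> S + \<mu> (gap_states n - S)"
    using S G.emeasure_space_1 unfolding \<mu>_def by (subst plus_emeasure) (auto simp: Un_absorb1)
  finally have "I S + I (gap_states n - S) \<le> \<mu> S + \<mu> (gap_states n - S)" .
  moreover have "I S + \<mu> (gap_states n - S) \<le> I S + I (gap_states n - S)"
    unfolding I_def \<mu>_def using transition_integral_ge[of "gap_states n - S"] t
    by (intro add_left_mono) auto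
  ultimately have "\<mu> (gap_states n - S) + I S \<le> \<mu> (gap_states n - S) + \<mu> S"
    unfolding add.commute[of "\<mu> (gap_states n - S)"] by (rule order_trans[rotated])
  moreover have "\<mu> (gap_states n - S) < \<top>"
    unfolding \<mu>_def by (simp add: G.emeasure_eq_measure)
  ultimately show "(\<integral>\<^sup>+g. gap_transition n M Y t (scale_gaps n g) (scale_gaps n ` S) \<partial>geometric_product n r) \<le>
      emeasure (geometric_product n r) S"
    by (simp add: I_def \<mu>_def ennreal_add_left_cancel_le)
qed (rule transition_integral_ge[OF S t])

lemma gap_law_stationary:
  "stationary_distribution (gap_space n) (gap_transition n M Y) (gap_law n r)"
  unfolding stationary_distribution_def
proof (intro conjI allI impI)
  show "prob_space (gap_law n r)"
    unfolding gap_law_def by (rule G.prob_space_distr) (rule measurable_scale_gaps)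
  fix t :: real and B assume t: "0 \<le> t" and B: "B \<subseteq> gap_space n"
  define S where "S = {g \<in> gap_states n. scale_gaps n g \<in> B}"
  have BS: "B = scale_gaps n ` S"
    using B by (auto simp: S_def gap_space_eq)
  have "(\<integral>\<^sup>+u. gap_transition n M Y t u B \<partial>gap_law n r) =
      (\<integral>\<^sup>+g. gap_transition n M Y t (scale_gaps n g) B \<partial>geometric_product n r)"
    unfolding gap_law_def by (rule nn_integral_distr) (auto simp: measurable_scale_gaps)
  also have "\<dots> = emeasure (geometric_product n r) S"
    unfolding BS by (rule transition_integral_eq[OF _ t]) (auto simp: S_def)
  also have "\<dots> = emeasure (gap_law n r) B"
    unfolding gap_law_def using B
    by (subst emeasure_distr) (auto simp: measurable_scale_gaps S_def intro!: arg_cong2[of _ _ _ _ emeasure])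
  finally show "(\<integral>\<^sup>+u. gap_transition n M Y t u B \<partial>gap_law n r) = emeasure (gap_law n r) B" .
qed (simp add: gap_law_def)

end

end

section \<open>The geometric ratios\<close>

lemma sqrt_mult_powr: "0 < n \<Longrightarrow> sqrt (real n) * real n = real n powr (3/2)"
proof -
  assume n: "0 < n"
  have "sqrt (real n) * real n = real n powr (1/2) * real n powr 1"
    using n by (simp add: powr_half_sqrt)
  also have "\<dots> = real n powr (3/2)"
    by (subst powr_add[symmetric]) simp
  finally show ?thesis .
qed

lemma pause_rho_reservoir: "pause_rho a b n (Suc n) = 1"
  by (simp add: pause_rho_def)

lemma pause_rho_rec:
  assumes "i \<in> {1..n}"
  shows "real n * pause_rho a b n i = arrival_rate a b n i * pause_rho a b n (Suc i)"
proof -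
  have n: "0 < n" using assms by auto
  define s where "s = sqrt (real n)"
  have s: "0 < s" "real n = s * s"
    using n by (auto simp: s_def)
  have "pause_rho a b n i =
      (1 - a / real n powr (3/2) + b / s * of_bool (i = 1)) * pause_rho a b n (Suc i)"
    unfolding pause_rho_def s_def using assms by (intro prod.atLeast_Suc_atMost) auto
  moreover have "real n * (1 - a / real n powr (3/2) + b / s * of_bool (i = 1)) = arrival_rate a b n i"
    unfolding arrival_rate_def sqrt_mult_powr[OF n, symmetric]
    unfolding s_def[symmetric] s(2) using s(1) by (auto simp: field_simps)
  ultimately show ?thesis
    by (metis mult.assoc)
qed

lemma pause_rho_eq_power:
  assumes "2 \<le> i"
  shows "pause_rho a b n i = (1 - a / real n powr (3/2)) ^ (Suc n - i)"
proof -
  have "pause_rho a b n i = (\<Prod>j=i..n. 1 - a / real n powr (3/2))"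
    unfolding pause_rho_def using assms by (intro prod.cong) auto
  then show ?thesis by simp
qed

lemma pause_rho_1:
  assumes "0 < n"
  shows "pause_rho a b n 1 =
    (1 - a / real n powr (3/2) + b / sqrt (real n)) * (1 - a / real n powr (3/2)) ^ (n - 1)"
proof -
  have "pause_rho a b n 1 = (1 - a / real n powr (3/2) + b / sqrt (real n)) * pause_rho a b n 2"
    unfolding pause_rho_def using assms
    by (subst prod.atLeast_Suc_atMost) (auto simp: numeral_2_eq_2)
  moreover have "Suc n - 2 = n - 1" by simp
  ultimately show ?thesis
    by (simp add: pause_rho_eq_power)
qed

context
  fixes a b :: real and n :: nat
  assumes b: "0 < b" and ab: "b < a" and large: "real n powr (3/2) > a"
begin

lemma n_pos: "0 < n"
  using b ab large by (cases n) auto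

lemma small_drift: "0 < a / real n powr (3/2)" "a / real n powr (3/2) < 1"
  using b ab large n_pos by (auto simp: field_simps)

lemma arrival_rate_pos: "0 < arrival_rate a b n i"
proof -
  have "a < sqrt (real n) * real n"
    using large sqrt_mult_powr[OF n_pos] by simp
  then have "a / sqrt (real n) < real n"
    using n_pos by (simp add: field_simps)
  moreover have "0 \<le> b * sqrt (real n)"
    using b by simp
  ultimately show ?thesis
    by (simp add: arrival_rate_def)
qed

lemma pause_rho_pos: "0 < pause_rho a b n i"
  unfolding pause_rho_def using b small_drift n_pos
  by (intro prod_pos) (auto intro!: add_pos_nonneg)

text \<open>For \<open>i = 1\<close> put \<open>y = a / n powr (3/2)\<close>. Then \<open>b < a\<close> gives \<open>b / sqrt n < n y\<close>, so the ratio is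
below \<open>(1 + (n - 1) y) (1 - y) ^ (n - 1)\<close>, which by Bernoulli's inequality is at most
\<open>(1 - y\<^sup>2) ^ (n - 1)\<close>.\<close>

lemma pause_rho_less_1:
  assumes i: "i \<in> {1..n}"
  shows "pause_rho a b n i < 1"
proof (cases "i = 1")
  case False
  then show ?thesis
    using i small_drift by (auto simp: pause_rho_eq_power power_less_one_iff)
next
  case True
  define y where "y = a / real n powr (3/2)"
  define s where "s = sqrt (real n)"
  have s: "0 < s" "real n = s * s"
    using n_pos by (auto simp: s_def)
  have y: "0 < y" "y < 1"
    using small_drift by (auto simp: y_def)
  have "b / s < a / s"
    using ab s by (simp add: divide_strict_right_mono)
  also have "a / s = real n * y"
    unfolding y_def sqrt_mult_powr[OF n_pos, symmetric]
    unfolding s_def[symmetric] s(2) using s(1) by simp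
  finally have "1 - y + b / s < 1 + real (n - 1) * y"
    using n_pos by (simp add: of_nat_diff algebra_simps)
  then have "pause_rho a b n 1 < (1 + real (n - 1) * y) * (1 - y) ^ (n - 1)"
    unfolding pause_rho_1[OF n_pos] y_def[symmetric] s_def[symmetric]
    using y by (intro mult_strict_right_mono) auto
  also have "\<dots> \<le> (1 + y) ^ (n - 1) * (1 - y) ^ (n - 1)"
    using y by (intro mult_right_mono Bernoulli_inequality) auto
  also have "\<dots> = (1 - y * y) ^ (n - 1)"
    by (simp add: power_mult_distrib[symmetric] algebra_simps)
  also have "\<dots> \<le> 1"
    using y by (intro power_le_one) (auto simp: mult_le_one)
  finally show ?thesis
    using True by simp
qed

end

text \<open>Each of the roughly \<open>n\<close> factors contributes \<open>a / n\<close> to \<open>- sqrt n ln r\<close>, and the factor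
\<open>j = 1\<close>, present only in the first ratio, contributes \<open>- b\<close>.\<close>

lemma pause_rho_log_limit:
  assumes b: "0 < b" and ab: "b < a"
  shows "(\<lambda>n. sqrt (real n) * - ln (pause_rho a b n (Suc k))) \<longlonglongrightarrow> (if k = 0 then a - b else a)"
proof -
  have "eventually (\<lambda>n. real n powr (3/2) > a) sequentially"
    by real_asymp
  then have ev: "eventually (\<lambda>n. real n powr (3/2) > a \<and> k < n) sequentially"
    using eventually_gt_at_top by (rule eventually_conj)
  show ?thesis
  proof (cases "k = 0")
    case True
    have "((\<lambda>n. sqrt (real n) * - (ln (1 - a / real n powr (3/2) + b / sqrt (real n)) +
        (real n - 1) * ln (1 - a / real n powr (3/2)))) \<longlongrightarrow> a - b) at_top"
      using b ab by real_asymp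
    moreover have "\<forall>\<^sub>F n in sequentially. sqrt (real n) * - (ln (1 - a / real n powr (3/2) + b / sqrt (real n)) +
        (real n - 1) * ln (1 - a / real n powr (3/2))) = sqrt (real n) * - ln (pause_rho a b n (Suc k))"
      using ev
    proof eventually_elim
      case (elim n)
      have y: "0 < 1 - a / real n powr (3/2)" "0 < n"
        using small_drift(2)[OF b ab] n_pos[OF b ab] elim by auto
      then have "0 < 1 - a / real n powr (3/2) + b / sqrt (real n)"
        using b by (intro add_pos_nonneg) auto
      then show ?case
        using y True pause_rho_1[OF y(2), of a b] by (simp add: ln_mult ln_realpow of_nat_diff)
    qed
    ultimately show ?thesis
      using True by (simp add: tendsto_cong)
  next
    case False
    have "((\<lambda>n. sqrt (real n) * - ((real n - real k) * ln (1 - a / real n powr (3/2)))) \<longlongrightarrow> a) at_top"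
      using b ab by real_asymp
    moreover have "\<forall>\<^sub>F n in sequentially. sqrt (real n) * - ((real n - real k) * ln (1 - a / real n powr (3/2)))
        = sqrt (real n) * - ln (pause_rho a b n (Suc k))"
      using ev
    proof eventually_elim
      case (elim n)
      have "0 < 1 - a / real n powr (3/2)"
        using small_drift(2)[OF b ab] elim by auto
      then show ?case
        using elim False by (simp add: pause_rho_eq_power ln_realpow of_nat_diff)
    qed
    ultimately have "(\<lambda>n. sqrt (real n) * - ln (pause_rho a b n (Suc k))) \<longlonglongrightarrow> a"
      by (rule Lim_transform_eventually)
    then show ?thesis
      using False by simp
  qed
qed

section \<open>Geometric variables as rounded exponential variables\<close>

lemma space_Exp_law: "space (Exp_law \<theta>) = {0..}"
  by (simp add: Exp_law_def space_restrict_space)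

lemma sets_Exp_law: "G \<in> sets borel \<Longrightarrow> G \<subseteq> {0..} \<Longrightarrow> G \<in> sets (Exp_law \<theta>)"
  unfolding Exp_law_def sets_restrict_space by (auto intro!: image_eqI[of _ _ G])

lemma emeasure_Exp_law:
  "G \<in> sets borel \<Longrightarrow> G \<subseteq> {0..} \<Longrightarrow> emeasure (Exp_law \<theta>) G = emeasure (density lborel (exponential_density \<theta>)) G"
  unfolding Exp_law_def by (rule emeasure_restrict_space) auto

context
  fixes \<theta> :: real
  assumes \<theta>: "0 < \<theta>"
begin

interpretation E: prob_space "density lborel (exponential_density \<theta>)"
  by (rule prob_space_exponential_density[OF \<theta>])

lemma measure_Exp_law_atLeast:
  assumes x: "0 \<le> x"
  shows "measure (Exp_law \<theta>) {x..} = exp (- \<theta> * x)"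
proof -
  have "emeasure (density lborel (exponential_density \<theta>)) {x} = 0"
    by (subst emeasure_density) (auto simp: nn_integral_indicator_singleton)
  then have null: "E.prob {x} = 0"
    by (simp add: measure_def)
  have "E.prob {..x} = 1 - exp (- \<theta> * x)"
    using x emeasure_erlang_density[OF \<theta>, of 0 x] by (simp add: measure_def erlang_CDF_0 \<theta> less_imp_le)
  then have "E.prob (UNIV - {..x}) = exp (- \<theta> * x)"
    using E.prob_compl[of "{..x}"] by simp
  moreover have "UNIV - {..x} = {x<..}" by auto
  moreover have "E.prob ({x} \<union> {x<..}) = E.prob {x} + E.prob {x<..}"
    by (rule E.finite_measure_Union) auto
  moreover have "{x} \<union> {x<..} = {x..}" by auto
  ultimately have "E.prob {x..} = exp (- \<theta> * x)"
    using null by simp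
  then show ?thesis
    using emeasure_Exp_law[of "{x..}"] x by (simp add: measure_def)
qed

lemma prob_space_Exp_law: "prob_space (Exp_law \<theta>)"
proof
  have "E.prob {0..} = 1"
    using measure_Exp_law_atLeast[of 0] emeasure_Exp_law[of "{0..}"] by (simp add: measure_def)
  then show "emeasure (Exp_law \<theta>) (space (Exp_law \<theta>)) = 1"
    by (simp add: space_Exp_law emeasure_Exp_law E.emeasure_eq_measure)
qed

lemma measure_Exp_law_slab:
  assumes x: "0 \<le> x" "x \<le> y"
  shows "measure (Exp_law \<theta>) {x..<y} = exp (- \<theta> * x) - exp (- \<theta> * y)"
proof -
  interpret X: prob_space "Exp_law \<theta>" by (rule prob_space_Exp_law)
  have "X.prob ({x..} - {y..}) = X.prob {x..} - X.prob {y..}"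
    using x by (intro X.finite_measure_Diff sets_Exp_law) auto
  moreover have "{x..} - {y..} = {x..<y}"
    using x by auto
  ultimately show ?thesis
    using x by (simp add: measure_Exp_law_atLeast)
qed

end

definition round_gaps :: "nat \<Rightarrow> (nat \<Rightarrow> real) \<Rightarrow> (nat \<Rightarrow> real) \<Rightarrow> nat \<Rightarrow> nat" where
  "round_gaps n c v = (\<lambda>i\<in>{1..n}. nat \<lfloor>v (i - 1) / c i\<rfloor>)"

lemma nat_floor_eq_iff:
  assumes "0 \<le> x" "0 < c"
  shows "nat \<lfloor>x / c\<rfloor> = k \<longleftrightarrow> x \<in> {real k * c..<real (Suc k) * c}"
proof -
  have "nat \<lfloor>x / c\<rfloor> = k \<longleftrightarrow> \<lfloor>x / c\<rfloor> = int k"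
    using assms by auto
  also have "\<dots> \<longleftrightarrow> real k \<le> x / c \<and> x / c < real k + 1"
    by (simp add: floor_eq_iff)
  also have "\<dots> \<longleftrightarrow> x \<in> {real k * c..<real (Suc k) * c}"
    using assms by (auto simp: field_simps)
  finally show ?thesis .
qed

lemma le_nat_floor_iff:
  assumes "0 \<le> x" "0 < c"
  shows "k \<le> nat \<lfloor>x / c\<rfloor> \<longleftrightarrow> x \<in> {real k * c..}"
proof -
  have "k \<le> nat \<lfloor>x / c\<rfloor> \<longleftrightarrow> int k \<le> \<lfloor>x / c\<rfloor>"
    using assms by (auto simp: le_nat_iff)
  also have "\<dots> \<longleftrightarrow> real k \<le> x / c"
    by (simp add: le_floor_iff)
  also have "\<dots> \<longleftrightarrow> x \<in> {real k * c..}"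
    using assms by (auto simp: field_simps)
  finally show ?thesis .
qed

definition exponential_product :: "(nat \<Rightarrow> real) \<Rightarrow> (nat \<Rightarrow> real) measure" where
  "exponential_product \<theta> = PiM UNIV (\<lambda>k. Exp_law (\<theta> k))"

lemma space_exponential_product: "space (exponential_product \<theta>) = nonneg_seqs"
  by (auto simp: exponential_product_def space_PiM space_Exp_law nonneg_seqs_def PiE_def Pi_def)

lemma prob_space_exponential_product:
  assumes "\<And>k. 0 < \<theta> k"
  shows "prob_space (exponential_product \<theta>)"
  unfolding exponential_product_def by (intro prob_space_PiM prob_space_Exp_law assms)

text \<open>The mesh for which rounding an exponential variable with parameter \<open>\<theta> (i - 1)\<close> down to a
multiple of it gives a geometric variable with ratio \<open>r i\<close>. The sequence \<open>\<theta>\<close> is indexed from \<open>0\<close>, gaps from \<open>1\<close>.\<close>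

definition cell_width :: "(nat \<Rightarrow> real) \<Rightarrow> (nat \<Rightarrow> real) \<Rightarrow> nat \<Rightarrow> real" where
  "cell_width \<theta> r i = - ln (r i) / \<theta> (i - 1)"

context
  fixes \<theta> r :: "nat \<Rightarrow> real" and n :: nat
  assumes \<theta>: "\<And>k. 0 < \<theta> k" and r: "\<And>i. i \<in> {1..n} \<Longrightarrow> 0 < r i \<and> r i < 1"
begin

interpretation product_prob_space "\<lambda>k. Exp_law (\<theta> k)" UNIV
  by (intro product_prob_spaceI prob_space_Exp_law \<theta>)

lemma cell_width_pos: "i \<in> {1..n} \<Longrightarrow> 0 < cell_width \<theta> r i"
  using \<theta>[of "i - 1"] r[of i] by (auto simp: cell_width_def intro!: divide_neg_pos)

lemma ratio_eq: "i \<in> {1..n} \<Longrightarrow> r i = exp (- \<theta> (i - 1) * cell_width \<theta> r i)"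
  using \<theta>[of "i - 1"] r[of i] by (simp add: cell_width_def)

lemma emeasure_cylinder:
  assumes G: "\<And>i. i \<in> {1..n} \<Longrightarrow> G i \<in> sets borel" "\<And>i. i \<in> {1..n} \<Longrightarrow> G i \<subseteq> {0..}"
  shows "{v \<in> space (exponential_product \<theta>). \<forall>i\<in>{1..n}. v (i - 1) \<in> G i} \<in> sets (exponential_product \<theta>)"
    and "emeasure (exponential_product \<theta>) {v \<in> space (exponential_product \<theta>). \<forall>i\<in>{1..n}. v (i - 1) \<in> G i} =
      ennreal (\<Prod>i=1..n. measure (Exp_law (\<theta> (i - 1))) (G i))"
proof -
  have G': "G (Suc k) \<in> sets (Exp_law (\<theta> k))" if "k \<in> {..<n}" for k
    using that G[of "Suc k"] by (intro sets_Exp_law) auto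
  have eq: "{v \<in> space (exponential_product \<theta>). \<forall>i\<in>{1..n}. v (i - 1) \<in> G i} =
      {v \<in> space (PiM UNIV (\<lambda>k. Exp_law (\<theta> k))). \<forall>k\<in>{..<n}. v k \<in> G (Suc k)}"
    unfolding exponential_product_def
  proof (intro Collect_cong conj_cong refl iffI ballI)
    fix v :: "nat \<Rightarrow> real" and i assume "\<forall>k\<in>{..<n}. v k \<in> G (Suc k)" "i \<in> {1..n}"
    then show "v (i - 1) \<in> G i" by (cases i) auto
  next
    fix v :: "nat \<Rightarrow> real" and k assume v: "\<forall>i\<in>{1..n}. v (i - 1) \<in> G i" and k: "k \<in> {..<n}"
    show "v k \<in> G (Suc k)" using bspec[OF v, of "Suc k"] k by auto
  qed
  show "{v \<in> space (exponential_product \<theta>). \<forall>i\<in>{1..n}. v (i - 1) \<in> G i} \<in> sets (exponential_product \<theta>)"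
    unfolding eq unfolding exponential_product_def
  proof (rule sets.sets_Collect_finite_All)
    fix k assume "k \<in> {..<n}"
    from G'[OF this] have [measurable]: "G (Suc k) \<in> sets (Exp_law (\<theta> k))" .
    show "{v \<in> space (PiM UNIV (\<lambda>k. Exp_law (\<theta> k))). v k \<in> G (Suc k)} \<in> sets (PiM UNIV (\<lambda>k. Exp_law (\<theta> k)))"
      by measurable
  qed simp
  have "emeasure (exponential_product \<theta>) {v \<in> space (exponential_product \<theta>). \<forall>i\<in>{1..n}. v (i - 1) \<in> G i} =
      (\<Prod>k<n. emeasure (Exp_law (\<theta> k)) (G (Suc k)))"
    unfolding eq unfolding exponential_product_def by (rule emeasure_PiM_Collect) (use G' in auto)
  also have "\<dots> = ennreal (\<Prod>k<n. measure (Exp_law (\<theta> k)) (G (Suc k)))"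
    by (simp add: M.emeasure_eq_measure prod_ennreal)
  also have "(\<Prod>k<n. measure (Exp_law (\<theta> k)) (G (Suc k))) =
      (\<Prod>i=1..n. measure (Exp_law (\<theta> (i - 1))) (G i))"
    by (simp add: prod.atLeast1_atMost_eq)
  finally show "emeasure (exponential_product \<theta>) {v \<in> space (exponential_product \<theta>). \<forall>i\<in>{1..n}. v (i - 1) \<in> G i} =
      ennreal (\<Prod>i=1..n. measure (Exp_law (\<theta> (i - 1))) (G i))" .
qed

lemma round_gaps_eq_iff:
  assumes v: "v \<in> nonneg_seqs" and g: "g \<in> gap_states n"
  shows "round_gaps n (cell_width \<theta> r) v = g \<longleftrightarrow>
    (\<forall>i\<in>{1..n}. v (i - 1) \<in> {real (g i) * cell_width \<theta> r i..<real (Suc (g i)) * cell_width \<theta> r i})"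
proof -
  have "round_gaps n (cell_width \<theta> r) v = g \<longleftrightarrow> (\<forall>i\<in>{1..n}. nat \<lfloor>v (i - 1) / cell_width \<theta> r i\<rfloor> = g i)"
  proof
    assume "\<forall>i\<in>{1..n}. nat \<lfloor>v (i - 1) / cell_width \<theta> r i\<rfloor> = g i"
    then show "round_gaps n (cell_width \<theta> r) v = g"
      using g by (intro gap_states_eqI[of _ n]) (auto simp: round_gaps_def)
  qed (auto simp: round_gaps_def)
  also have "\<dots> \<longleftrightarrow> (\<forall>i\<in>{1..n}. v (i - 1) \<in> {real (g i) * cell_width \<theta> r i..<real (Suc (g i)) * cell_width \<theta> r i})"
    using v cell_width_pos by (intro ball_cong refl nat_floor_eq_iff) (auto simp: nonneg_seqs_def)
  finally show ?thesis .
qed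

lemma slab_sets:
  assumes i: "i \<in> {1..n}"
  shows "{real (g i) * cell_width \<theta> r i..<real (Suc (g i)) * cell_width \<theta> r i} \<subseteq> {0..}" "{real (g i) * cell_width \<theta> r i..} \<subseteq> {0..}"
proof -
  have "0 \<le> real (g i) * cell_width \<theta> r i"
    using cell_width_pos[OF i] by simp
  then show "{real (g i) * cell_width \<theta> r i..<real (Suc (g i)) * cell_width \<theta> r i} \<subseteq> {0..}" "{real (g i) * cell_width \<theta> r i..} \<subseteq> {0..}"
    by auto
qed

lemma round_gaps_measurable: "round_gaps n (cell_width \<theta> r) \<in> measurable (exponential_product \<theta>) (count_space (gap_states n))"
proof (subst measurable_count_space_eq_countable[OF countable_gap_states], intro conjI ballI)
  show "round_gaps n (cell_width \<theta> r) \<in> space (exponential_product \<theta>) \<rightarrow> gap_states n"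
    by (auto simp: round_gaps_def)
  fix g assume g: "g \<in> gap_states n"
  have "round_gaps n (cell_width \<theta> r) -` {g} \<inter> space (exponential_product \<theta>) =
      {v \<in> space (exponential_product \<theta>). \<forall>i\<in>{1..n}. v (i - 1) \<in> {real (g i) * cell_width \<theta> r i..<real (Suc (g i)) * cell_width \<theta> r i}}"
    using round_gaps_eq_iff[OF _ g] by (auto simp: space_exponential_product)
  also have "\<dots> \<in> sets (exponential_product \<theta>)"
    by (rule emeasure_cylinder) (use slab_sets(1) in simp_all)
  finally show "round_gaps n (cell_width \<theta> r) -` {g} \<inter> space (exponential_product \<theta>) \<in> sets (exponential_product \<theta>)" .
qed

text \<open>The rounded sequence is in a given state iff each coordinate lies in a cell
\<open>[g\<^sub>i c\<^sub>i, (g\<^sub>i + 1) c\<^sub>i)\<close>, which has exponential mass \<open>r\<^sub>i ^ g\<^sub>i - r\<^sub>i ^ (g\<^sub>i + 1)\<close>.\<close>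

lemma distr_round_gaps: "distr (exponential_product \<theta>) (count_space (gap_states n)) (round_gaps n (cell_width \<theta> r)) = geometric_product n r"
proof (rule measure_eqI_countable[OF _ _ countable_gap_states])
  fix g assume g: "g \<in> gap_states n"
  have "emeasure (distr (exponential_product \<theta>) (count_space (gap_states n)) (round_gaps n (cell_width \<theta> r))) {g} =
      emeasure (exponential_product \<theta>) (round_gaps n (cell_width \<theta> r) -` {g} \<inter> space (exponential_product \<theta>))"
    using g by (intro emeasure_distr round_gaps_measurable) auto
  also have "round_gaps n (cell_width \<theta> r) -` {g} \<inter> space (exponential_product \<theta>) =
      {v \<in> space (exponential_product \<theta>). \<forall>i\<in>{1..n}. v (i - 1) \<in> {real (g i) * cell_width \<theta> r i..<real (Suc (g i)) * cell_width \<theta> r i}}"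
    using round_gaps_eq_iff[OF _ g] by (auto simp: space_exponential_product)
  also have "emeasure (exponential_product \<theta>) \<dots> = ennreal (\<Prod>i=1..n. measure (Exp_law (\<theta> (i - 1)))
      {real (g i) * cell_width \<theta> r i..<real (Suc (g i)) * cell_width \<theta> r i})"
    by (rule emeasure_cylinder) (use slab_sets(1) in simp_all)
  also have "(\<Prod>i=1..n. measure (Exp_law (\<theta> (i - 1))) {real (g i) * cell_width \<theta> r i..<real (Suc (g i)) * cell_width \<theta> r i}) =
      geometric_weight n r g"
    unfolding geometric_weight_def
  proof (rule prod.cong)
    fix i assume i: "i \<in> {1..n}"
    have "measure (Exp_law (\<theta> (i - 1))) {real (g i) * cell_width \<theta> r i..<real (Suc (g i)) * cell_width \<theta> r i} =
        exp (- \<theta> (i - 1) * (real (g i) * cell_width \<theta> r i)) - exp (- \<theta> (i - 1) * (real (Suc (g i)) * cell_width \<theta> r i))"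
      using cell_width_pos[OF i] by (intro measure_Exp_law_slab \<theta>) auto
    also have "\<dots> = r i ^ g i - r i ^ Suc (g i)"
      unfolding ratio_eq[OF i] exp_of_nat_mult[symmetric] by (simp add: algebra_simps)
    also have "\<dots> = (1 - r i) * r i ^ g i"
      by (simp add: algebra_simps)
    finally show "measure (Exp_law (\<theta> (i - 1))) {real (g i) * cell_width \<theta> r i..<real (Suc (g i)) * cell_width \<theta> r i} =
        (1 - r i) * r i ^ g i" .
  qed simp
  also have "ennreal (geometric_weight n r g) = emeasure (geometric_product n r) {g}"
    unfolding geometric_product_def by (rule emeasure_density_count_space_singleton[OF g, symmetric])
  finally show "emeasure (distr (exponential_product \<theta>) (count_space (gap_states n)) (round_gaps n (cell_width \<theta> r))) {g} =
    emeasure (geometric_product n r) {g}" .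
qed auto

lemma prob_space_geometric_product: "prob_space (geometric_product n r)"
proof -
  interpret X: prob_space "exponential_product \<theta>" by (rule prob_space_exponential_product[OF \<theta>])
  show ?thesis
    unfolding distr_round_gaps[symmetric] by (rule X.prob_space_distr[OF round_gaps_measurable])
qed

lemma geometric_product_tail:
  "measure (geometric_product n r) {g \<in> gap_states n. \<forall>i\<in>{1..n}. k i \<le> g i} = (\<Prod>i=1..n. r i ^ k i)"
proof -
  have "measure (geometric_product n r) {g \<in> gap_states n. \<forall>i\<in>{1..n}. k i \<le> g i} =
      measure (exponential_product \<theta>) (round_gaps n (cell_width \<theta> r) -` {g \<in> gap_states n. \<forall>i\<in>{1..n}. k i \<le> g i} \<inter> space (exponential_product \<theta>))"
    unfolding distr_round_gaps[symmetric] by (rule measure_distr[OF round_gaps_measurable]) auto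
  also have "round_gaps n (cell_width \<theta> r) -` {g \<in> gap_states n. \<forall>i\<in>{1..n}. k i \<le> g i} \<inter> space (exponential_product \<theta>) =
      {v \<in> space (exponential_product \<theta>). \<forall>i\<in>{1..n}. v (i - 1) \<in> {real (k i) * cell_width \<theta> r i..}}"
  proof -
    have "round_gaps n (cell_width \<theta> r) v \<in> {g \<in> gap_states n. \<forall>i\<in>{1..n}. k i \<le> g i} \<longleftrightarrow>
        (\<forall>i\<in>{1..n}. v (i - 1) \<in> {real (k i) * cell_width \<theta> r i..})" if "v \<in> nonneg_seqs" for v
    proof -
      have "round_gaps n (cell_width \<theta> r) v \<in> {g \<in> gap_states n. \<forall>i\<in>{1..n}. k i \<le> g i} \<longleftrightarrow>
          (\<forall>i\<in>{1..n}. k i \<le> nat \<lfloor>v (i - 1) / cell_width \<theta> r i\<rfloor>)"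
        by (auto simp: round_gaps_def)
      also have "\<dots> \<longleftrightarrow> (\<forall>i\<in>{1..n}. v (i - 1) \<in> {real (k i) * cell_width \<theta> r i..})"
        using that cell_width_pos by (intro ball_cong refl le_nat_floor_iff) (auto simp: nonneg_seqs_def)
      finally show ?thesis .
    qed
    then show ?thesis unfolding space_exponential_product by blast
  qed
  also have "measure (exponential_product \<theta>) \<dots> = (\<Prod>i=1..n. measure (Exp_law (\<theta> (i - 1))) {real (k i) * cell_width \<theta> r i..})"
    using slab_sets(2) by (subst measure_def, subst emeasure_cylinder(2)) (auto simp: prod_nonneg)
  also have "\<dots> = (\<Prod>i=1..n. r i ^ k i)"
  proof (rule prod.cong)
    fix i assume i: "i \<in> {1..n}"
    have "measure (Exp_law (\<theta> (i - 1))) {real (k i) * cell_width \<theta> r i..} = exp (- \<theta> (i - 1) * (real (k i) * cell_width \<theta> r i))"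
      using cell_width_pos[OF i] by (intro measure_Exp_law_atLeast \<theta>) auto
    also have "\<dots> = r i ^ k i"
      unfolding ratio_eq[OF i] exp_of_nat_mult[symmetric] by (simp add: algebra_simps)
    finally show "measure (Exp_law (\<theta> (i - 1))) {real (k i) * cell_width \<theta> r i..} = r i ^ k i" .
  qed simp
  finally show ?thesis .
qed

end

section \<open>Weak convergence to the exponential product law\<close>

definition round_seq :: "nat \<Rightarrow> (nat \<Rightarrow> real) \<Rightarrow> (nat \<Rightarrow> real) \<Rightarrow> nat \<Rightarrow> real" where
  "round_seq n c v = (\<lambda>k. if k < n then real (nat \<lfloor>v k / c (Suc k)\<rfloor>) / sqrt (real n) else 0)"

text \<open>All the stationary laws are images of one and the same measure, under roundings that depend on
\<open>n\<close>; this coupling replaces convergence in law by pointwise convergence.\<close>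

lemma as_seq_gap_law:
  assumes \<theta>: "\<And>k. 0 < \<theta> k" and r: "\<And>i. i \<in> {1..n} \<Longrightarrow> 0 < r i \<and> r i < 1"
  shows "as_seq_measure n (gap_law n r) =
      distr (exponential_product \<theta>) (restrict_space borel nonneg_seqs) (round_seq n (cell_width \<theta> r))"
    and "round_seq n (cell_width \<theta> r) \<in> measurable (exponential_product \<theta>) (restrict_space borel nonneg_seqs)"
proof -
  define s where "s g k = (if k < n then real (g (k + 1)) / sqrt (real n) else 0)" for g :: "nat \<Rightarrow> nat" and k
  have ext: "(\<lambda>v k. if k < n then v (k + 1) else 0) \<in>
      measurable (count_space (gap_space n)) (restrict_space borel nonneg_seqs)"
    by (auto simp: space_restrict_space nonneg_seqs_def gap_space_def PiE_def Pi_def image_def)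
      (metis divide_nonneg_nonneg of_nat_0_le_iff real_sqrt_ge_zero Suc_leI Suc_le_mono le0)
  have s: "s = (\<lambda>v k. if k < n then v (k + 1) else 0) \<circ> scale_gaps n"
    by (auto simp: s_def scale_gaps_def fun_eq_iff)
  have meas_s: "s \<in> measurable (count_space (gap_states n)) (restrict_space borel nonneg_seqs)"
    by (auto simp: space_restrict_space nonneg_seqs_def s_def)
  have round: "round_seq n (cell_width \<theta> r) = s \<circ> round_gaps n (cell_width \<theta> r)"
    by (auto simp: round_seq_def s_def round_gaps_def fun_eq_iff)
  have meas_round: "round_gaps n (cell_width \<theta> r) \<in>
      measurable (exponential_product \<theta>) (count_space (gap_states n))"
    by (rule round_gaps_measurable[OF \<theta> r])
  have law: "distr (exponential_product \<theta>) (count_space (gap_states n)) (round_gaps n (cell_width \<theta> r)) =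
      geometric_product n r"
    by (rule distr_round_gaps[OF \<theta> r])
  show "round_seq n (cell_width \<theta> r) \<in> measurable (exponential_product \<theta>) (restrict_space borel nonneg_seqs)"
    unfolding round by (rule measurable_comp[OF meas_round meas_s])
  have "as_seq_measure n (gap_law n r) = distr (geometric_product n r) (restrict_space borel nonneg_seqs) s"
    unfolding as_seq_measure_def gap_law_def s by (rule distr_distr[OF ext measurable_scale_gaps])
  also have "\<dots> = distr (exponential_product \<theta>) (restrict_space borel nonneg_seqs) (round_seq n (cell_width \<theta> r))"
    unfolding law[symmetric] round by (rule distr_distr[OF meas_s meas_round])
  finally show "as_seq_measure n (gap_law n r) = \<dots>" .
qed

lemma tendsto_coordinatewise:
  fixes f :: "'a \<Rightarrow> 'i \<Rightarrow> 'b::topological_space"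
  assumes "\<And>i. ((\<lambda>x. f x i) \<longlongrightarrow> l i) F"
  shows "(f \<longlongrightarrow> l) F"
proof -
  have "limitin (product_topology (\<lambda>_. euclidean) UNIV) f l F"
    unfolding limitin_componentwise using assms by auto
  then show ?thesis
    by (simp add: euclidean_product_topology)
qed

text \<open>Rounding down loses less than one cell, so the rounded coordinate differs from
\<open>v k / (sqrt n c)\<close> by at most \<open>1 / sqrt n\<close>.\<close>

lemma round_seq_tendsto:
  assumes v: "v \<in> nonneg_seqs"
    and c: "\<And>k. \<forall>\<^sub>F n in sequentially. 0 < c n (Suc k)"
    and lim: "\<And>k. (\<lambda>n. sqrt (real n) * c n (Suc k)) \<longlonglongrightarrow> 1"
  shows "(\<lambda>n. round_seq n (c n) v) \<longlonglongrightarrow> v"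
proof (rule tendsto_coordinatewise)
  fix k
  have x: "0 \<le> v k" using v by (simp add: nonneg_seqs_def)
  define u where "u n = v k / (sqrt (real n) * c n (Suc k))" for n
  have u: "u \<longlonglongrightarrow> v k"
    unfolding u_def using tendsto_divide[OF tendsto_const lim, of "v k" k] by simp
  have "(\<lambda>n. 1 / sqrt (real n)) \<longlonglongrightarrow> 0"
    by real_asymp
  then have low: "(\<lambda>n. u n - 1 / sqrt (real n)) \<longlonglongrightarrow> v k"
    using tendsto_diff[OF u] by fastforce
  have ev: "\<forall>\<^sub>F n in sequentially. 0 < c n (Suc k) \<and> k < n"
    using c eventually_gt_at_top by (rule eventually_conj)
  have bounds: "u n - 1 / sqrt (real n) \<le> round_seq n (c n) v k \<and> round_seq n (c n) v k \<le> u n"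
    if "0 < c n (Suc k) \<and> k < n" for n
  proof -
    have s: "0 < sqrt (real n)" using that by simp
    define q where "q = v k / c n (Suc k)"
    have q: "0 \<le> q" using x that by (simp add: q_def)
    have "q - 1 \<le> real (nat \<lfloor>q\<rfloor>)" "real (nat \<lfloor>q\<rfloor>) \<le> q"
      using q by linarith+
    then have "(q - 1) / sqrt (real n) \<le> real (nat \<lfloor>q\<rfloor>) / sqrt (real n)"
      "real (nat \<lfloor>q\<rfloor>) / sqrt (real n) \<le> q / sqrt (real n)"
      using s by (auto intro!: divide_right_mono)
    moreover have "u n = q / sqrt (real n)"
      by (simp add: u_def q_def)
    ultimately show ?thesis
      using that by (simp add: round_seq_def q_def[symmetric] diff_divide_distrib)
  qed
  show "(\<lambda>n. round_seq n (c n) v k) \<longlonglongrightarrow> v k"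
    using ev bounds by (intro tendsto_sandwich[OF _ _ low u]) (auto elim: eventually_mono)
qed

lemma gap_law_weak_limit:
  assumes \<theta>: "\<And>k. 0 < \<theta> k"
    and r: "\<forall>\<^sub>F n in sequentially. \<forall>i\<in>{1..n}. 0 < r n i \<and> r n i < 1"
    and lim: "\<And>k. (\<lambda>n. sqrt (real n) * - ln (r n (Suc k))) \<longlonglongrightarrow> \<theta> k"
  shows "weakly_converges_on nonneg_seqs (\<lambda>n. as_seq_measure n (gap_law n (r n))) (exponential_product \<theta>)"
  unfolding weakly_converges_on_def
proof (intro allI impI, elim conjE)
  fix f :: "(nat \<Rightarrow> real) \<Rightarrow> real"
  assume cont: "continuous_on nonneg_seqs f" and bdd: "bounded (f ` nonneg_seqs)"
  obtain K where K: "\<And>v. v \<in> nonneg_seqs \<Longrightarrow> \<bar>f v\<bar> \<le> K"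
    using bdd by (auto simp: bounded_iff)
  define c where "c n = cell_width \<theta> (r n)" for n
  interpret X: prob_space "exponential_product \<theta>"
    by (rule prob_space_exponential_product[OF \<theta>])
  have space: "space (exponential_product \<theta>) = nonneg_seqs"
    by (rule space_exponential_product)
  have f: "f \<in> borel_measurable (restrict_space borel nonneg_seqs)"
    using cont by (rule borel_measurable_continuous_on_restrict)
  have coord: "(\<lambda>v. v k) \<in> borel_measurable (exponential_product \<theta>)" for k
  proof -
    have "(\<lambda>x. x) \<in> borel_measurable (Exp_law (\<theta> k))"
      unfolding Exp_law_def by (rule measurable_restrict_space1) simp
    moreover have "(\<lambda>v. v k) \<in> measurable (exponential_product \<theta>) (Exp_law (\<theta> k))"
      unfolding exponential_product_def by (rule measurable_component_singleton) simp
    ultimately show ?thesis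
      by (rule measurable_compose[rotated])
  qed
  have "(\<lambda>v. v) \<in> measurable (exponential_product \<theta>) (restrict_space borel nonneg_seqs)"
    by (rule measurable_restrict_space2)
      (auto simp: space intro: measurable_coordinatewise_then_product coord)
  then have f_limit: "f \<in> borel_measurable (exponential_product \<theta>)"
    by (rule measurable_compose[OF _ f])
  \<comment> \<open>The coupling is available only from some index on, so the sequence is shifted by it.\<close>
  obtain N where N: "\<And>n. N \<le> n \<Longrightarrow> \<forall>i\<in>{1..n}. 0 < r n i \<and> r n i < 1"
    using r by (auto simp: eventually_sequentially)
  have round: "round_seq n (c n) \<in> measurable (exponential_product \<theta>) (restrict_space borel nonneg_seqs)"
    if "N \<le> n" for n
    unfolding c_def by (rule as_seq_gap_law(2)[OF \<theta>]) (use N[OF that] in auto)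
  have law: "(\<integral>v. f v \<partial>as_seq_measure n (gap_law n (r n))) =
      (\<integral>v. f (round_seq n (c n) v) \<partial>exponential_product \<theta>)" if "N \<le> n" for n
  proof -
    have "as_seq_measure n (gap_law n (r n)) =
        distr (exponential_product \<theta>) (restrict_space borel nonneg_seqs) (round_seq n (c n))"
      unfolding c_def by (rule as_seq_gap_law(1)[OF \<theta>]) (use N[OF that] in auto)
    then show ?thesis
      by (simp only:) (rule integral_distr[OF round[OF that] f])
  qed
  have c_pos: "\<forall>\<^sub>F n in sequentially. 0 < c n (Suc k)" for k
    using eventually_ge_at_top[of N] eventually_gt_at_top[of k]
  proof eventually_elim
    case (elim n)
    then show ?case
      unfolding c_def using N[of n] by (intro cell_width_pos[where n = n] \<theta>) auto
  qed
  have c_lim: "(\<lambda>n. sqrt (real n) * c n (Suc k)) \<longlonglongrightarrow> 1" for k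
  proof -
    have "(\<lambda>n. sqrt (real n) * - ln (r n (Suc k)) / \<theta> k) \<longlonglongrightarrow> \<theta> k / \<theta> k"
      using \<theta>[of k] by (intro tendsto_divide lim tendsto_const) auto
    then show ?thesis
      using \<theta>[of k] by (simp add: c_def cell_width_def)
  qed
  have maps: "round_seq n (c n) v \<in> nonneg_seqs" for n v
    by (simp add: nonneg_seqs_def round_seq_def)
  have "(\<lambda>n. \<integral>v. f (round_seq (n + N) (c (n + N)) v) \<partial>exponential_product \<theta>)
      \<longlonglongrightarrow> (\<integral>v. f v \<partial>exponential_product \<theta>)"
  proof (rule integral_dominated_convergence[where w = "\<lambda>_. K"])
    show "(\<lambda>v. f (round_seq (n + N) (c (n + N)) v)) \<in> borel_measurable (exponential_product \<theta>)" for n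
      by (rule measurable_compose[OF round f]) simp
    show "AE v in exponential_product \<theta>. (\<lambda>n. f (round_seq (n + N) (c (n + N)) v)) \<longlonglongrightarrow> f v"
    proof (rule AE_I2)
      fix v assume "v \<in> space (exponential_product \<theta>)"
      then have v: "v \<in> nonneg_seqs" by (simp add: space)
      have "(\<lambda>n. round_seq n (c n) v) \<longlonglongrightarrow> v"
        using v c_pos c_lim by (rule round_seq_tendsto)
      then have "(\<lambda>n. f (round_seq n (c n) v)) \<longlonglongrightarrow> f v"
        using v maps by (intro continuous_on_tendsto_compose[OF cont]) auto
      then show "(\<lambda>n. f (round_seq (n + N) (c (n + N)) v)) \<longlonglongrightarrow> f v"
        by (rule LIMSEQ_ignore_initial_segment)
    qed
  qed (use f_limit K maps in auto)
  then have "(\<lambda>n. \<integral>v. f v \<partial>as_seq_measure (n + N) (gap_law (n + N) (r (n + N))))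
      \<longlonglongrightarrow> (\<integral>v. f v \<partial>exponential_product \<theta>)"
    by (simp add: law)
  then show "(\<lambda>n. \<integral>v. f v \<partial>as_seq_measure n (gap_law n (r n))) \<longlonglongrightarrow> (\<integral>v. f v \<partial>exponential_product \<theta>)"
    by (rule LIMSEQ_offset)
qed

lemma gap_law_tail:
  assumes n: "0 < n" and r: "\<And>i. i \<in> {1..n} \<Longrightarrow> 0 < r i \<and> r i < 1" and z: "z \<in> gap_space n"
  shows "measure (gap_law n r) (gap_space n \<inter> (\<Pi>\<^sub>E i\<in>{1..n}. {z i..})) =
    (\<Prod>i=1..n. r i powr (sqrt (real n) * z i))"
proof -
  have "z \<in> scale_gaps n ` gap_states n"
    using z by (simp add: gap_space_eq)
  then obtain k where k: "k \<in> gap_states n" "z = scale_gaps n k"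
    by blast
  have "measure (gap_law n r) (gap_space n \<inter> (\<Pi>\<^sub>E i\<in>{1..n}. {z i..})) =
      measure (geometric_product n r)
        (scale_gaps n -` (gap_space n \<inter> (\<Pi>\<^sub>E i\<in>{1..n}. {z i..})) \<inter> gap_states n)"
    unfolding gap_law_def by (subst measure_distr[OF measurable_scale_gaps]) auto
  also have "scale_gaps n -` (gap_space n \<inter> (\<Pi>\<^sub>E i\<in>{1..n}. {z i..})) \<inter> gap_states n =
      {g \<in> gap_states n. \<forall>i\<in>{1..n}. k i \<le> g i}"
  proof -
    have "scale_gaps n g \<in> (\<Pi>\<^sub>E i\<in>{1..n}. {z i..}) \<longleftrightarrow> (\<forall>i\<in>{1..n}. k i \<le> g i)" for g
      using n by (auto simp: k(2) scale_gaps_def PiE_def Pi_def divide_le_cancel)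
    then show ?thesis
      using scale_gaps_in_gap_space by blast
  qed
  also have "measure (geometric_product n r) \<dots> = (\<Prod>i=1..n. r i ^ k i)"
    by (rule geometric_product_tail[of "\<lambda>_. 1"]) (use r in auto)
  also have "\<dots> = (\<Prod>i=1..n. r i powr (sqrt (real n) * z i))"
    using n r by (intro prod.cong) (auto simp: k(2) scale_gaps_def powr_realpow)
  finally show ?thesis .
qed

section \<open>Existence, uniqueness and limit of the stationary distributions\<close>

theorem theorem2p6:
  fixes a b :: real
    and M :: "nat \<Rightarrow> 'w measure"
    and A D :: "nat \<Rightarrow> nat \<Rightarrow> 'w \<Rightarrow> (real \<times> real) measure"
    and Y :: "nat \<Rightarrow> (nat \<Rightarrow> real) \<Rightarrow> nat \<Rightarrow> real \<Rightarrow> 'w \<Rightarrow> real"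
  assumes "0 < b" and "b < a"
    and "\<And>n. real n powr (3/2) > a \<Longrightarrow> system_with_pauses a b n (M n) (A n) (D n) (Y n)"
  shows "\<exists>\<pi> :: nat \<Rightarrow> (nat \<Rightarrow> real) measure.
    (\<forall>n. real n powr (3/2) > a \<longrightarrow>
       stationary_distribution (gap_space n) (gap_transition n (M n) (Y n)) (\<pi> n) \<and>
       (\<forall>\<pi>'. stationary_distribution (gap_space n) (gap_transition n (M n) (Y n)) \<pi>' \<longrightarrow>
             \<pi>' = \<pi> n) \<and>
       (\<forall>z\<in>gap_space n.
          measure (\<pi> n) (gap_space n \<inter> (\<Pi>\<^sub>E i\<in>{1..n}. {z i..})) =
          (\<Prod>i=1..n. pause_rho a b n i powr (sqrt (real n) * z i)))) \<and>
    weakly_converges_on nonneg_seqs (\<lambda>n. as_seq_measure n (\<pi> n)) (mu_limit a b)"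
proof (intro exI conjI allI impI ballI)
  let ?\<pi> = "\<lambda>n. gap_law n (pause_rho a b n)"
  note ab = assms(1,2)
  have \<rho>: "0 < pause_rho a b n i \<and> pause_rho a b n i < 1"
    if "real n powr (3/2) > a" "i \<in> {1..n}" for n i
    using pause_rho_pos[OF ab that(1)] pause_rho_less_1[OF ab that] by blast
  {
    fix n assume large: "real n powr (3/2) > a"
    note sys = assms(3)[OF large] and n = n_pos[OF ab large]
    have rate: "0 < source_rate a b n j" for j
      using arrival_rate_pos[OF ab large] n by (cases j) (auto simp: source_rate_def)
    show stat: "stationary_distribution (gap_space n) (gap_transition n (M n) (Y n)) (?\<pi> n)"
    proof (rule gap_law_stationary[OF sys n])
      show "0 \<le> pause_rho a b n k" for k
        using pause_rho_pos[OF ab large] by (rule less_imp_le)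
      show "arrival_rate a b n i * pause_rho a b n (Suc i) = real n * pause_rho a b n i"
        if "i \<in> {1..n}" for i
        using pause_rho_rec[OF that] by simp
      show "prob_space (geometric_product n (pause_rho a b n))"
        by (rule prob_space_geometric_product[of "\<lambda>_. 1"]) (use \<rho>[OF large] in auto)
    qed (auto simp: rate less_imp_le pause_rho_reservoir)
    show "\<pi>' = ?\<pi> n" if "stationary_distribution (gap_space n) (gap_transition n (M n) (Y n)) \<pi>'" for \<pi>'
    proof (rule stationary_distribution_unique[OF countable_gap_space _ stat that])
      show "(0::real) \<le> 1" by simp
    qed (auto intro!: gap_transition_split[OF sys n] gap_transition_positive[OF sys n] rate)
    show "measure (?\<pi> n) (gap_space n \<inter> (\<Pi>\<^sub>E i\<in>{1..n}. {z i..})) =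
        (\<Prod>i=1..n. pause_rho a b n i powr (sqrt (real n) * z i))" if "z \<in> gap_space n" for z
      by (rule gap_law_tail[OF n _ that]) (use \<rho>[OF large] in auto)
  }
  show "weakly_converges_on nonneg_seqs (\<lambda>n. as_seq_measure n (?\<pi> n)) (mu_limit a b)"
    unfolding mu_limit_def exponential_product_def[symmetric]
  proof (rule gap_law_weak_limit)
    show "0 < (if k = 0 then a - b else a)" for k :: nat
      using ab by simp
    have "\<forall>\<^sub>F n in sequentially. real n powr (3/2) > a"
      by real_asymp
    then show "\<forall>\<^sub>F n in sequentially. \<forall>i\<in>{1..n}. 0 < pause_rho a b n i \<and> pause_rho a b n i < 1"
      by eventually_elim (use \<rho> in blast)
    show "(\<lambda>n. sqrt (real n) * - ln (pause_rho a b n (Suc k))) \<longlonglongrightarrow> (if k = 0 then a - b else a)" for k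
      by (rule pause_rho_log_limit[OF ab])
  qed
qed

end
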